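(* Consider the impulsive delay system $$\frac{dx(t)}{dt}=f(t,x(t),x(t-h)),\quad t\neq t_k,\qquad x(t_k+0)=x(t_k)+I_k(x(t_k)),\quad k\in\mathbb{Z},$$ where $x\in\mathbb{R}^n$, $h>0$ is a constant, and: (1) the sequence $\{t_k\}$ has uniformly almost periodic differences; (2) $f(t,x,y)$ is W-almost periodic in $t$ and Lipschitz in $x$ and $y$ uniformly for $x,y$ in compact sets, its sequence of discontinuities in $t$ being $\{t_k\}$; (3) the sequence $\{I_k(x)\}$ is almost periodic uniformly with respect to $x$ in compact sets, and each $I_k$ is Lipschitz in $x$. Suppose the system has a solution $\xi(t)$ defined on $[0,\infty)$ with $\|\xi(t)\|\le B$ for all $t\ge0$ (for some constant $B$). If $\xi(t)$ is W-asymptotically almost periodic, then the system has a W-almost periodic solution $p(t)$.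
   Context: For $J\subset\mathbb{R}$, $\mathcal{PC}^k(J,\mathbb{R}^n)$ denotes the piecewise continuous functions $x:J\to\mathbb{R}^n$ whose discontinuities form an increasing sequence $\{t_j\}$, with $x(t_j-0)=x(t_j)$, finite right limits $x(t_j+0)$, and $x$ of class $C^k$ away from the discontinuities. A sequence $\{t_k\}$ has uniformly almost periodic differences if for every $\varepsilon>0$ there is a relatively dense set of $\varepsilon$-almost periods common to all sequences $\{t_{k+j}-t_k\}_k$, $j\in\mathbb{Z}$. A function $\varphi\in\mathcal{PC}^k(\mathbb{R},\mathbb{R}^n)$ is W-almost periodic if (i) its sequence of discontinuities $\{t_k\}$ has uniformly almost periodic differences; (ii) for every $\varepsilon>0$ there is $\delta>0$ such that $\|\varphi(t')-\varphi(t'')\|<\varepsilon$ whenever $t',t''$ lie in the same interval of continuity and $|t'-t''|<\delta$; (iii) for every $\varepsilon>0$ there is a relatively dense set $\Gamma$ such that for $\tau\in\Gamma$, $\|\varphi(t+\tau)-\varphi(t)\|<\varepsilon$ for all $t$ with $|t-t_k|\ge\varepsilon$ for all $k$. A sequence $\{I_k(x)\}$ is almost periodic uniformly in $x$ on compact sets if for every $\varepsilon>0$ and compact $K$ the set of integers $p$ with $\|I_{k+p}(x)-I_k(x)\|<\varepsilon$ for all $k$, $x\in K$ is relatively dense. A piecewise continuous function is W-asymptotically almost periodic if it equals $p(t)+q(t)$ with $p$ W-almost periodic and $q$ piecewise continuous with $q(t)\to0$ as $t\to\infty$. *)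

theory Defs
  imports "HOL-Analysis.Analysis"
begin

definition disc_seq :: "(int \<Rightarrow> real) \<Rightarrow> bool" where
  "disc_seq \<tau> \<longleftrightarrow> strict_mono \<tau> \<and> filterlim \<tau> at_top at_top \<and> filterlim \<tau> at_bot at_bot"

definition rel_dense_int :: "int set \<Rightarrow> bool" where
  "rel_dense_int P \<longleftrightarrow> (\<exists>l>0. \<forall>a. \<exists>p\<in>P. a \<le> p \<and> p \<le> a + l)"

definition rel_dense_real :: "real set \<Rightarrow> bool" where
  "rel_dense_real \<Gamma> \<longleftrightarrow> (\<exists>l>0. \<forall>a. \<exists>s\<in>\<Gamma>. a \<le> s \<and> s \<le> a + l)"

definition uap_differences :: "(int \<Rightarrow> real) \<Rightarrow> bool" where
  "uap_differences t \<longleftrightarrow>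
     (\<forall>\<epsilon>>0. \<exists>P. rel_dense_int P \<and>
        (\<forall>p\<in>P. \<forall>j k. \<bar>(t (k + p + j) - t (k + p)) - (t (k + j) - t k)\<bar> < \<epsilon>))"

definition PC_wrt :: "(int \<Rightarrow> real) \<Rightarrow> real set \<Rightarrow> (real \<Rightarrow> 'a::real_normed_vector) \<Rightarrow> bool" where
  "PC_wrt \<tau> J x \<longleftrightarrow>
     (\<forall>t\<in>J. t \<notin> range \<tau> \<longrightarrow> continuous (at t within J) x) \<and>
     (\<forall>k. \<tau> k \<in> J \<longrightarrow> continuous (at (\<tau> k) within (J \<inter> {..\<tau> k})) x \<and>
                       (\<exists>L. (x \<longlongrightarrow> L) (at_right (\<tau> k))))"

definition PC_on :: "real set \<Rightarrow> (real \<Rightarrow> 'a::real_normed_vector) \<Rightarrow> bool" where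
  "PC_on J x \<longleftrightarrow> (\<exists>\<tau>. disc_seq \<tau> \<and> PC_wrt \<tau> J x)"

definition same_interval :: "(int \<Rightarrow> real) \<Rightarrow> real \<Rightarrow> real \<Rightarrow> bool" where
  "same_interval \<tau> t' t'' \<longleftrightarrow>
     (\<exists>k. \<tau> k < t' \<and> t' \<le> \<tau> (k + 1) \<and> \<tau> k < t'' \<and> t'' \<le> \<tau> (k + 1))"

definition W_ap_wrt :: "(int \<Rightarrow> real) \<Rightarrow> (real \<Rightarrow> 'a::real_normed_vector) \<Rightarrow> bool" where
  "W_ap_wrt \<tau> \<phi> \<longleftrightarrow>
     disc_seq \<tau> \<and> PC_wrt \<tau> UNIV \<phi> \<and>
     uap_differences \<tau> \<and>
     (\<forall>\<epsilon>>0. \<exists>\<delta>>0. \<forall>t' t''. same_interval \<tau> t' t'' \<and> \<bar>t' - t''\<bar> < \<delta> \<longrightarrow>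
                        norm (\<phi> t' - \<phi> t'') < \<epsilon>) \<and>
     (\<forall>\<epsilon>>0. \<exists>\<Gamma>. rel_dense_real \<Gamma> \<and>
        (\<forall>s\<in>\<Gamma>. \<forall>t. (\<forall>k. \<bar>t - \<tau> k\<bar> \<ge> \<epsilon>) \<longrightarrow> norm (\<phi> (t + s) - \<phi> t) < \<epsilon>))"

definition W_almost_periodic :: "(real \<Rightarrow> 'a::real_normed_vector) \<Rightarrow> bool" where
  "W_almost_periodic \<phi> \<longleftrightarrow> (\<exists>\<tau>. W_ap_wrt \<tau> \<phi>)"

definition W_asymp_almost_periodic :: "(real \<Rightarrow> 'a::real_normed_vector) \<Rightarrow> bool" where
  "W_asymp_almost_periodic \<xi> \<longleftrightarrow>
     (\<exists>p q. W_almost_periodic p \<and> PC_on {0..} q \<and> (q \<longlongrightarrow> 0) at_top \<and>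
            (\<forall>t\<ge>0. \<xi> t = p t + q t))"

definition W_ap_uniform :: "(int \<Rightarrow> real) \<Rightarrow> (real \<Rightarrow> 'a::real_normed_vector \<Rightarrow> 'a \<Rightarrow> 'a) \<Rightarrow> bool" where
  "W_ap_uniform \<tau> f \<longleftrightarrow>
     disc_seq \<tau> \<and> uap_differences \<tau> \<and>
     (\<forall>x y. PC_wrt \<tau> UNIV (\<lambda>t. f t x y)) \<and>
     (\<forall>K. compact K \<longrightarrow>
        (\<forall>\<epsilon>>0. \<exists>\<delta>>0. \<forall>x\<in>K. \<forall>y\<in>K. \<forall>t' t''. same_interval \<tau> t' t'' \<and> \<bar>t' - t''\<bar> < \<delta> \<longrightarrow>
                          norm (f t' x y - f t'' x y) < \<epsilon>) \<and>
        (\<forall>\<epsilon>>0. \<exists>\<Gamma>. rel_dense_real \<Gamma> \<and>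
           (\<forall>s\<in>\<Gamma>. \<forall>t. (\<forall>k. \<bar>t - \<tau> k\<bar> \<ge> \<epsilon>) \<longrightarrow>
              (\<forall>x\<in>K. \<forall>y\<in>K. norm (f (t + s) x y - f t x y) < \<epsilon>))))"

definition lipschitz_xy_compact :: "(real \<Rightarrow> 'a::real_normed_vector \<Rightarrow> 'a \<Rightarrow> 'a) \<Rightarrow> bool" where
  "lipschitz_xy_compact f \<longleftrightarrow>
     (\<forall>K. compact K \<longrightarrow> (\<exists>L. \<forall>t. \<forall>x\<in>K. \<forall>x'\<in>K. \<forall>y\<in>K. \<forall>y'\<in>K.
         norm (f t x y - f t x' y') \<le> L * (norm (x - x') + norm (y - y'))))"

definition ap_seq_uniform :: "(int \<Rightarrow> 'a::real_normed_vector \<Rightarrow> 'a) \<Rightarrow> bool" where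
  "ap_seq_uniform I \<longleftrightarrow>
     (\<forall>\<epsilon>>0. \<forall>K. compact K \<longrightarrow>
        rel_dense_int {p. \<forall>k. \<forall>x\<in>K. norm (I (k + p) x - I k x) < \<epsilon>})"

text \<open>Solution of the impulsive delay system on the interval \<open>J\<close>
  (\<open>J = {0..}\<close> or \<open>J = UNIV\<close>); values on \<open>[inf J - h, inf J)\<close> act as initial function.
  The differential equation is required away from the impulse points \<open>t_k\<close> and the points
  \<open>t_k + h\<close> (where \<open>x(t-h)\<close> jumps), where only continuity is required.\<close>
definition impulsive_solution ::
  "(int \<Rightarrow> real) \<Rightarrow> real \<Rightarrow> (real \<Rightarrow> 'a::real_normed_vector \<Rightarrow> 'a \<Rightarrow> 'a) \<Rightarrow> (int \<Rightarrow> 'a \<Rightarrow> 'a)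
    \<Rightarrow> real set \<Rightarrow> (real \<Rightarrow> 'a) \<Rightarrow> bool" where
  "impulsive_solution tk h f I J x \<longleftrightarrow>
     (\<forall>t\<in>J. t \<notin> range tk \<longrightarrow> continuous (at t within J) x) \<and>
     (\<forall>t\<in>J. t \<notin> range tk \<and> t - h \<notin> range tk \<longrightarrow>
        (x has_vector_derivative f t (x t) (x (t - h))) (at t within J)) \<and>
     (\<forall>k. tk k \<in> J \<longrightarrow>
        continuous (at (tk k) within (J \<inter> {..tk k})) x \<and>
        (x \<longlongrightarrow> x (tk k) + I k (x (tk k))) (at_right (tk k)))"

end

theory Submission
  imports Defs
begin

text \<open>
  If \<open>\<xi> = p + q\<close> with \<open>q\<close> vanishing at infinity, then \<open>p\<close> itself is the required solution. By the pigeonhole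
  principle there are shifts \<open>\<sigma>\<close> tending to infinity, with index shifts \<open>m\<close>, such that \<open>t\<^bsub>k+m\<^esub> - \<sigma>\<close> is
  close to \<open>t\<^sub>k\<close>, \<open>I\<^bsub>k+m\<^esub>\<close> is close to \<open>I\<^sub>k\<close>, and \<open>\<sigma>\<close> is close to a difference of two almost periods both
  for \<open>p\<close> and for \<open>f\<close>. Such a difference need not be an almost period, because the exceptional
  neighbourhoods of the discontinuities get translated; but these points have bounded density, so every
  short interval contains a point at which the translate by \<open>\<sigma>\<close> is close. For \<open>f\<close> uniform continuity
  on the intervals of continuity spreads this to all points, so the translates of \<open>\<xi>\<close> are equi-Lipschitz
  between consecutive impulses. They therefore converge to \<open>p\<close> there, including at the impulse points,
  and the equation and the jump conditions pass to the limit. The discontinuity sequence of \<open>p\<close> may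
  differ from \<open>t\<^sub>k\<close>, and the gaps of \<open>t\<^sub>k\<close> may be arbitrarily small.
\<close>

section \<open>Discontinuity sequences: intervals, finiteness, bounded density\<close>

lemma disc_seq_interval:
  assumes "disc_seq \<tau>"
  obtains k where "\<tau> k < u" "u \<le> \<tau> (k + 1)"
proof -
  have mono: "strict_mono \<tau>" and top: "filterlim \<tau> at_top at_top" and bot: "filterlim \<tau> at_bot at_bot"
    using assms by (auto simp: disc_seq_def)
  obtain a where a: "\<tau> a < u"
    using bot by (auto simp: filterlim_at_bot_dense eventually_at_bot_linorder)
  obtain b where b: "u \<le> \<tau> b"
    using top by (auto simp: filterlim_at_top eventually_at_top_linorder)
  have ab: "a \<le> b"
    using a b strict_mono_less_eq[OF mono, of b a] by linarith
  have "\<exists>k. \<tau> k < u \<and> u \<le> \<tau> (k + 1)" if "\<tau> a < u" "u \<le> \<tau> b"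
    using ab that
  proof (induction b rule: int_ge_induct)
    case (step i)
    then show ?case by (cases "u \<le> \<tau> i") (blast, metis not_le)
  qed simp
  with a b that show thesis by blast
qed

lemma disc_seq_finite:
  assumes "disc_seq \<tau>"
  shows "finite {t \<in> range \<tau>. a \<le> t \<and> t \<le> b}"
proof -
  have mono: "strict_mono \<tau>" using assms by (simp add: disc_seq_def)
  obtain i where i: "\<tau> i < a" using disc_seq_interval[OF assms] by metis
  obtain j where j: "b \<le> \<tau> (j + 1)" using disc_seq_interval[OF assms] by metis
  have "{t \<in> range \<tau>. a \<le> t \<and> t \<le> b} \<subseteq> \<tau> ` {i..j+1}"
  proof clarify
    fix k assume "a \<le> \<tau> k" "\<tau> k \<le> b"
    with i j have "\<tau> i \<le> \<tau> k" "\<tau> k \<le> \<tau> (j+1)" by linarith+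
    then show "\<tau> k \<in> \<tau> ` {i..j+1}"
      by (simp add: strict_mono_less_eq[OF mono])
  qed
  then show ?thesis by (rule finite_subset) simp
qed

text \<open>A common almost period \<open>p\<close> moves the index \<open>k\<close> into the fixed
  window from 0 to \<open>l\<close>, where a single \<open>N\<close> serves every index; moving back
  changes the difference by less than 1. So the points have bounded density although single gaps may
  be tiny.\<close>

lemma uap_differences_bounded_density:
  assumes "disc_seq \<tau>" "uap_differences \<tau>"
  obtains N :: nat where "\<And>k. 1 \<le> \<tau> (k + int N) - \<tau> k"
proof -
  have mono: "strict_mono \<tau>" and top: "filterlim \<tau> at_top at_top"
    using assms by (auto simp: disc_seq_def)
  obtain P where P: "rel_dense_int P"
    and close: "\<And>p j k. p \<in> P \<Longrightarrow> \<bar>(\<tau> (k + p + j) - \<tau> (k + p)) - (\<tau> (k + j) - \<tau> k)\<bar> < 1"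
    using assms(2) unfolding uap_differences_def by (meson zero_less_one)
  obtain l where l: "l > 0" "\<And>a. \<exists>p\<in>P. a \<le> p \<and> p \<le> a + l"
    using P by (auto simp: rel_dense_int_def)
  \<comment> \<open>Asking for 2 instead of 1 leaves room for the error in
    \<open>close\<close>.\<close>
  obtain b where b: "\<And>k. k \<ge> b \<Longrightarrow> \<tau> l + 2 \<le> \<tau> k"
    using top by (force simp: filterlim_at_top eventually_at_top_linorder)
  define N where "N = nat (max 0 b)"
  show thesis
  proof
    fix k :: int
    obtain p where p: "p \<in> P" "- k \<le> p" "p \<le> - k + l" using l(2) by blast
    have "\<tau> (k + p) \<le> \<tau> l"
      using p by (intro monoD[OF strict_mono_mono[OF mono]]) simp
    moreover have "\<tau> l + 2 \<le> \<tau> (k + p + int N)"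
      using p by (intro b) (simp add: N_def)
    ultimately show "1 \<le> \<tau> (k + int N) - \<tau> k"
      using close[OF p(1), of k "int N"] by linarith
  qed
qed

text \<open>If each of \<open>N + 1\<close> grid points with spacing \<open>2 * \<epsilon>\<close>
  were closer than \<epsilon> to a discontinuity, the indices of these discontinuities would
  strictly increase, forcing a span of at least 1 into a stretch shorter than 1. The \<epsilon>
  serves all positions \<open>a\<close> at once, so the window can later be translated
  freely.\<close>

lemma uap_differences_points_away:
  assumes "disc_seq \<tau>" "uap_differences \<tau>" and "\<delta> > 0"
  obtains \<epsilon> where "\<epsilon> > 0" "\<And>a. \<exists>w\<in>{a..a+\<delta>}. \<forall>k. \<epsilon> \<le> \<bar>w - \<tau> k\<bar>"
proof -
  have mono: "strict_mono \<tau>" using assms by (auto simp: disc_seq_def)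
  obtain N :: nat where N: "\<And>k. 1 \<le> \<tau> (k + int N) - \<tau> k"
    using uap_differences_bounded_density[OF assms(1,2)] by blast
  \<comment> \<open>The factor \<delta> keeps the grid inside the window, the factor 1 contradicts
    the density bound.\<close>
  define \<epsilon> where "\<epsilon> = min \<delta> 1 / (2 * (real N + 1))"
  have pos: "\<epsilon> > 0" using assms(3) by (simp add: \<epsilon>_def)
  have "2 * \<epsilon> * (real N + 1) = min \<delta> 1"
    by (simp add: \<epsilon>_def field_simps)
  then have eps: "2 * \<epsilon> * (real N + 1) \<le> \<delta>" "2 * \<epsilon> * (real N + 1) \<le> 1" by auto
  show thesis
  proof (rule that[OF pos])
    fix a
    show "\<exists>w\<in>{a..a+\<delta>}. \<forall>k. \<epsilon> \<le> \<bar>w - \<tau> k\<bar>"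
    proof (rule ccontr)
      assume contra: "\<not> ?thesis"
      define w where "w i = a + 2 * \<epsilon> * real i" for i :: nat
      have "w i \<in> {a..a+\<delta>}" if "i \<le> N" for i
      proof -
        have "2 * \<epsilon> * real i \<le> 2 * \<epsilon> * (real N + 1)"
          using that pos by (intro mult_left_mono) auto
        then have "2 * \<epsilon> * real i \<le> \<delta>" using eps(1) by (rule order_trans)
        then show ?thesis using pos by (simp add: w_def)
      qed
      then have "\<forall>i. \<exists>k. i \<le> N \<longrightarrow> \<bar>w i - \<tau> k\<bar> < \<epsilon>"
        using contra by (meson not_le)
      then obtain \<kappa> where \<kappa>: "\<And>i. i \<le> N \<Longrightarrow> \<bar>w i - \<tau> (\<kappa> i)\<bar> < \<epsilon>" by metis
      have ge: "\<kappa> 0 + int i \<le> \<kappa> i" if "i \<le> N" for i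
        using that
      proof (induction i)
        case (Suc i)
        have "\<tau> (\<kappa> i) < \<tau> (\<kappa> (Suc i))"
          using \<kappa>[of i] \<kappa>[of "Suc i"] Suc.prems by (simp add: w_def algebra_simps)
        then have "\<kappa> i < \<kappa> (Suc i)" by (simp add: strict_mono_less[OF mono])
        with Suc show ?case by simp
      qed simp
      have "\<tau> (\<kappa> 0 + int N) \<le> \<tau> (\<kappa> N)"
        using ge[of N] by (simp add: strict_mono_less_eq[OF mono])
      with N[of "\<kappa> 0"] have "1 \<le> \<tau> (\<kappa> N) - \<tau> (\<kappa> 0)" by linarith
      moreover have "\<tau> (\<kappa> N) - \<tau> (\<kappa> 0) < 2 * \<epsilon> * (real N + 1)"
        using \<kappa>[of 0] \<kappa>[of N] by (simp add: w_def algebra_simps)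
      ultimately show False using eps by linarith
    qed
  qed
qed

section \<open>Shifts common to impulse times, impulse maps and sets of almost periods\<close>

text \<open>Each index almost period of \<open>t\<close> induces a real shift, and elements of the
  other relatively dense sets lie at bounded distance from it. After rounding there are finitely
  many patterns of distances, so infinitely many of these shifts share one pattern, and subtracting
  two of them cancels the distances. This is why differences of almost periods appear.\<close>

lemma common_translations:
  fixes t :: "int \<Rightarrow> real" and I :: "int \<Rightarrow> 'a::real_normed_vector \<Rightarrow> 'a"
  assumes "disc_seq t" "uap_differences t" "ap_seq_uniform I" "compact K"
    and \<Gamma>: "rel_dense_real \<Gamma>\<^sub>1" "rel_dense_real \<Gamma>\<^sub>2" and "\<epsilon> > 0"
  obtains \<sigma> m where "\<sigma> \<ge> A"
    "\<And>k. \<bar>t (k + m) - t k - \<sigma>\<bar> < \<epsilon>"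
    "\<And>k x. x \<in> K \<Longrightarrow> norm (I (k + m) x - I k x) < \<epsilon>"
    "\<exists>s\<in>\<Gamma>\<^sub>1. \<exists>s'\<in>\<Gamma>\<^sub>1. \<bar>\<sigma> - (s - s')\<bar> < \<epsilon>"
    "\<exists>s\<in>\<Gamma>\<^sub>2. \<exists>s'\<in>\<Gamma>\<^sub>2. \<bar>\<sigma> - (s - s')\<bar> < \<epsilon>"
proof -
  have top: "filterlim t at_top at_top"
    using assms by (auto simp: disc_seq_def)
  have e2: "\<epsilon> / 2 > 0" using \<open>\<epsilon> > 0\<close> by simp
  obtain P where P: "rel_dense_int P"
    and Pc: "\<And>p j k. p \<in> P \<Longrightarrow> \<bar>(t (k + p + j) - t (k + p)) - (t (k + j) - t k)\<bar> < \<epsilon> / 2"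
    using assms(2) e2 unfolding uap_differences_def by meson
  define Q where "Q = {p. \<forall>k. \<forall>x\<in>K. norm (I (k + p) x - I k x) < \<epsilon> / 2}"
  have Q: "rel_dense_int Q"
    using assms(3,4) e2 unfolding ap_seq_uniform_def Q_def by blast
  obtain p' lP where p': "\<And>a. p' a \<in> P \<and> a \<le> p' a \<and> p' a \<le> a + lP"
    using P unfolding rel_dense_int_def by metis
  obtain q' lQ where q': "\<And>a. q' a \<in> Q \<and> a \<le> q' a \<and> q' a \<le> a + lQ"
    using Q unfolding rel_dense_int_def by metis
  obtain s' l1 where s': "\<And>a. s' a \<in> \<Gamma>\<^sub>1 \<and> a \<le> s' a \<and> s' a \<le> a + l1"
    using \<Gamma>(1) unfolding rel_dense_real_def by metis
  obtain v' l2 where v': "\<And>a. v' a \<in> \<Gamma>\<^sub>2 \<and> a \<le> v' a \<and> v' a \<le> a + l2"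
    using \<Gamma>(2) unfolding rel_dense_real_def by metis
  \<comment> \<open>\<open>p n\<close> is the index shift and \<open>r n\<close> its real
    counterpart; \<open>q n\<close>, \<open>s n\<close>, \<open>v n\<close> are the neighbours in
    the other three sets.\<close>
  define p where "p n = p' (int n)" for n :: nat
  define r where "r n = t (p n) - t 0" for n
  define q where "q n = q' (p n)" for n
  define s where "s n = s' (r n)" for n
  define v where "v n = v' (r n)" for n
  have p: "\<And>n. p n \<in> P" "\<And>n. int n \<le> p n"
    and q: "\<And>n. q n \<in> Q" "\<And>n. p n \<le> q n" "\<And>n. q n \<le> p n + lQ"
    and s: "\<And>n. s n \<in> \<Gamma>\<^sub>1" "\<And>n. r n \<le> s n" "\<And>n. s n \<le> r n + l1"
    and v: "\<And>n. v n \<in> \<Gamma>\<^sub>2" "\<And>n. r n \<le> v n" "\<And>n. v n \<le> r n + l2"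
    using p' q' s' v' by (auto simp: p_def q_def s_def v_def)
  \<comment> \<open>The integer offset is recorded exactly, the real offsets only up to cells of
    length \<epsilon>.\<close>
  define F where "F n = (q n - p n, \<lfloor>(s n - r n) / \<epsilon>\<rfloor>, \<lfloor>(v n - r n) / \<epsilon>\<rfloor>)" for n
  have "range F \<subseteq> {0..lQ} \<times> {0..\<lfloor>l1 / \<epsilon>\<rfloor>} \<times> {0..\<lfloor>l2 / \<epsilon>\<rfloor>}"
  proof (rule image_subsetI)
    fix n
    have "(s n - r n) / \<epsilon> \<le> l1 / \<epsilon>" "(v n - r n) / \<epsilon> \<le> l2 / \<epsilon>"
      using s(3)[of n] v(3)[of n] \<open>\<epsilon> > 0\<close> by (auto intro!: divide_right_mono simp: algebra_simps)
    then show "F n \<in> {0..lQ} \<times> {0..\<lfloor>l1 / \<epsilon>\<rfloor>} \<times> {0..\<lfloor>l2 / \<epsilon>\<rfloor>}"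
      using q(2)[of n] q(3)[of n] s(2)[of n] v(2)[of n] \<open>\<epsilon> > 0\<close>
      by (simp add: F_def floor_mono)
  qed
  then have "finite (range F)" by (rule finite_subset) simp
  then obtain n0 where n0: "infinite {n. F n = F n0}"
    using pigeonhole_infinite[of "UNIV :: nat set" F] by auto
  obtain b where b: "\<And>k. k \<ge> b \<Longrightarrow> A + t (p n0) \<le> t k"
    using top by (force simp: filterlim_at_top eventually_at_top_linorder)
  obtain n where n: "F n = F n0" "n \<ge> nat b"
    using n0 unfolding infinite_nat_iff_unbounded_le by blast
  define m where "m = p n - p n0"
  define \<sigma> where "\<sigma> = r n - r n0"
  \<comment> \<open>Exact agreement of the integer offsets makes one \<open>m\<close> serve both for
    the times and for the impulse maps.\<close>
  have mq: "m = q n - q n0" using n(1) by (simp add: F_def m_def)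
  have close: "\<bar>x - y\<bar> < \<epsilon>" if "\<lfloor>x / \<epsilon>\<rfloor> = \<lfloor>y / \<epsilon>\<rfloor>" for x y
  proof -
    have "\<bar>x / \<epsilon> - y / \<epsilon>\<bar> < 1" using that by linarith
    then show ?thesis using \<open>\<epsilon> > 0\<close> by (simp add: diff_divide_distrib[symmetric] abs_divide)
  qed
  show thesis
  proof
    have "b \<le> p n" using p(2)[of n] n(2) by linarith
    then show "A \<le> \<sigma>" using b[of "p n"] by (simp add: \<sigma>_def r_def)
  next
    fix k
    \<comment> \<open>Both estimates compare with the same difference
      \<open>t (k - p n0) - t 0\<close>, which cancels. The impulse maps are treated alike, with
      base index \<open>k - q n0\<close>.\<close>
    show "\<bar>t (k + m) - t k - \<sigma>\<bar> < \<epsilon>"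
      using Pc[OF p(1)[of n], of 0 "k - p n0"] Pc[OF p(1)[of n0], of 0 "k - p n0"]
      unfolding abs_less_iff by (simp add: \<sigma>_def r_def m_def algebra_simps)
  next
    fix k x assume x: "x \<in> K"
    have "norm (I (k - q n0 + q n) x - I (k - q n0) x) < \<epsilon> / 2"
      "norm (I (k - q n0 + q n0) x - I (k - q n0) x) < \<epsilon> / 2"
      using q(1) x unfolding Q_def by blast+
    then have "norm ((I (k - q n0 + q n) x - I (k - q n0) x) - (I (k - q n0 + q n0) x - I (k - q n0) x)) < \<epsilon>"
      by norm
    then show "norm (I (k + m) x - I k x) < \<epsilon>" by (simp add: mq algebra_simps)
  next
    have "\<bar>\<sigma> - (s n - s n0)\<bar> < \<epsilon>"
      using close[of "s n - r n" "s n0 - r n0"] n(1) by (simp add: F_def \<sigma>_def)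
    then show "\<exists>s\<in>\<Gamma>\<^sub>1. \<exists>s'\<in>\<Gamma>\<^sub>1. \<bar>\<sigma> - (s - s')\<bar> < \<epsilon>" using s(1) by blast
  next
    have "\<bar>\<sigma> - (v n - v n0)\<bar> < \<epsilon>"
      using close[of "v n - r n" "v n0 - r n0"] n(1) by (simp add: F_def \<sigma>_def)
    then show "\<exists>s\<in>\<Gamma>\<^sub>2. \<exists>s'\<in>\<Gamma>\<^sub>2. \<bar>\<sigma> - (s - s')\<bar> < \<epsilon>" using v(1) by blast
  qed
qed

text \<open>Up to the small error \<open>e\<close>, \<sigma> is \<open>s - s'\<close>. Both
  \<open>s\<close> and \<open>s'\<close> are applied to one base point \<open>w\<close> away from
  the discontinuities, so the values at \<open>w + s\<close> and \<open>w + s'\<close> are both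
  close to the value at \<open>w\<close>. The parameter \<open>i\<close> makes one \<open>u'\<close>
  and one \<open>e\<close> serve all of \<open>X\<close>.\<close>

lemma almost_period_difference:
  fixes \<phi> :: "real \<Rightarrow> 'i \<Rightarrow> 'a::real_normed_vector"
  assumes "disc_seq \<tau>" "uap_differences \<tau>"
    and \<epsilon>: "\<epsilon> \<longlonglongrightarrow> 0"
    and \<Gamma>: "\<And>n s t i. s \<in> \<Gamma> n \<Longrightarrow> (\<And>k. \<epsilon> n \<le> \<bar>t - \<tau> k\<bar>) \<Longrightarrow> i \<in> X \<Longrightarrow> norm (\<phi> (t + s) i - \<phi> t i) < \<epsilon> n"
    and \<sigma>: "\<And>n. \<exists>s\<in>\<Gamma> n. \<exists>s'\<in>\<Gamma> n. \<bar>\<sigma> n - (s - s')\<bar> < \<epsilon> n"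
    and "\<delta> > 0" "\<eta> > 0"
  shows "\<forall>\<^sub>F n in sequentially. \<exists>u'\<in>{u..u+\<delta>}. \<exists>e. \<bar>e\<bar> < \<eta> \<and>
           (\<forall>i\<in>X. norm (\<phi> (u' + \<sigma> n) i - \<phi> (u' + e) i) < \<eta>)"
proof -
  obtain \<epsilon>0 where \<epsilon>0: "\<epsilon>0 > 0" "\<And>a. \<exists>w\<in>{a..a+\<delta>}. \<forall>k. \<epsilon>0 \<le> \<bar>w - \<tau> k\<bar>"
    using uap_differences_points_away[OF assms(1,2) \<open>\<delta> > 0\<close>] by blast
  have "\<forall>\<^sub>F n in sequentially. \<epsilon> n < min \<epsilon>0 (\<eta> / 2)"
    using \<epsilon>0(1) \<open>\<eta> > 0\<close> by (intro order_tendstoD(2)[OF \<epsilon>]) auto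
  then show ?thesis
  proof eventually_elim
    case (elim n)
    obtain s s' where s: "s \<in> \<Gamma> n" "s' \<in> \<Gamma> n" "\<bar>\<sigma> n - (s - s')\<bar> < \<epsilon> n" using \<sigma> by blast
    define e where "e = \<sigma> n - (s - s')"
    obtain w where w: "w \<in> {u - s' + e..u - s' + e + \<delta>}" "\<And>k. \<epsilon>0 \<le> \<bar>w - \<tau> k\<bar>"
      using \<epsilon>0(2) by blast
    have away: "\<epsilon> n \<le> \<bar>w - \<tau> k\<bar>" for k using w(2)[of k] elim by linarith
    \<comment> \<open>With this choice \<open>u' + \<sigma> n\<close> is \<open>w + s\<close> and
      \<open>u' + e\<close> is \<open>w + s'\<close>; the window for \<open>w\<close> was translated
      so that \<open>u'\<close> lands in the required one.\<close>
    define u' where "u' = w + s' - e"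
    have "norm (\<phi> (u' + \<sigma> n) i - \<phi> (u' + e) i) < \<eta>" if "i \<in> X" for i
    proof -
      have eq: "u' + \<sigma> n = w + s" "u' + e = w + s'" by (auto simp: u'_def e_def)
      have "norm (\<phi> (w + s) i - \<phi> w i) < \<epsilon> n" "norm (\<phi> (w + s') i - \<phi> w i) < \<epsilon> n"
        using \<Gamma> s away that by blast+
      then have "norm ((\<phi> (w + s) i - \<phi> w i) - (\<phi> (w + s') i - \<phi> w i)) < \<epsilon> n + \<epsilon> n" by norm
      then show ?thesis unfolding eq using elim by simp
    qed
    moreover have "\<bar>e\<bar> < \<eta>" using s(3) elim \<open>\<eta> > 0\<close> by (simp add: e_def)
    moreover have "u' \<in> {u..u+\<delta>}" using w(1) by (auto simp: u'_def)
    ultimately show ?case by blast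
  qed
qed

section \<open>Two estimates for increments on an interval\<close>

text \<open>Integrating \<open>x' - c\<close> tolerates finitely many points without a derivative,
  as occur where the delayed argument meets an impulse. With \<open>c = 0\<close> it yields
  Lipschitz bounds, with \<open>c\<close> a value of the right-hand side it yields the derivative of
  the limit.\<close>

lemma norm_increment_le:
  fixes x :: "real \<Rightarrow> 'a::banach"
  assumes "finite S" "a \<le> b" "continuous_on {a..b} x" "0 \<le> M"
    and der: "\<And>v. v \<in> {a<..<b} - S \<Longrightarrow> (x has_vector_derivative x' v) (at v)"
    and bd: "\<And>v. v \<in> {a<..<b} - S \<Longrightarrow> norm (x' v - c) \<le> M"
  shows "norm (x b - x a - (b - a) *\<^sub>R c) \<le> M * (b - a)"
proof -
  have "(x' has_integral (x b - x a)) {a..b}"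
    using assms by (intro fundamental_theorem_of_calculus_interior_strong[of S]) auto
  moreover have "((\<lambda>_. c) has_integral (b - a) *\<^sub>R c) {a..b}"
    using has_integral_const_real[of c a b] \<open>a \<le> b\<close> by simp
  ultimately have "((\<lambda>v. x' v - c) has_integral (x b - x a - (b - a) *\<^sub>R c)) (cbox a b)"
    by (simp add: has_integral_diff)
  then have "norm (x b - x a - (b - a) *\<^sub>R c) \<le> M * measure lborel (cbox a b)"
    using assms by (intro has_integral_bound_spike_finite[where S = "S \<union> {a, b}"]) auto
  then show ?thesis using \<open>a \<le> b\<close> by simp
qed

text \<open>A chain of \<open>j\<close> steps, each of length at most \<open>\<delta> / 2\<close>
  and hence below \<delta>, stays inside the interval by convexity and gains at most 1 per
  step.\<close>

lemma norm_diff_le_steps: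
  fixes \<phi> :: "real \<Rightarrow> 'a::real_normed_vector"
  assumes uc: "\<And>u v. u \<in> {a<..b} \<Longrightarrow> v \<in> {a<..b} \<Longrightarrow> \<bar>u - v\<bar> < \<delta> \<Longrightarrow> norm (\<phi> u - \<phi> v) \<le> 1"
    and "\<delta> > 0" "u \<in> {a<..b}" "v \<in> {a<..b}" "\<bar>u - v\<bar> \<le> real j * (\<delta> / 2)"
  shows "norm (\<phi> u - \<phi> v) \<le> real j"
  using assms(3-5)
proof (induction j arbitrary: u)
  case (Suc j)
  \<comment> \<open>This point leaves one of \<open>j + 1\<close> equal parts towards
    \<open>u\<close> and \<open>j\<close> parts towards \<open>v\<close> for the induction
    hypothesis.\<close>
  define w where "w = v + (u - v) * (real j / (real j + 1))"
  have wv: "\<bar>w - v\<bar> = \<bar>u - v\<bar> * (real j / (real j + 1))"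
    by (simp add: w_def abs_mult)
  have wu: "u - w = (u - v) / (real j + 1)"
    by (simp add: w_def field_simps)
  have "\<bar>u - v\<bar> / (real j + 1) \<le> \<delta> / 2"
    using Suc.prems(3) by (simp add: field_simps)
  then have uw: "\<bar>u - w\<bar> < \<delta>" and "\<bar>w - v\<bar> \<le> real j * (\<delta> / 2)"
    using \<open>\<delta> > 0\<close> mult_left_mono[of "\<bar>u - v\<bar> / (real j + 1)" "\<delta> / 2" "real j"]
    by (auto simp: wu wv abs_divide mult.commute)
  moreover have "w \<in> closed_segment v u"
    unfolding in_segment
  proof (intro exI conjI)
    show "w = (1 - real j / (real j + 1)) *\<^sub>R v + (real j / (real j + 1)) *\<^sub>R u"
      unfolding w_def real_scaleR_def by algebra
  qed auto
  then have "w \<in> {a<..b}"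
    using Suc.prems(1,2) by (auto simp: closed_segment_eq_real_ivl split: if_splits)
  ultimately have "norm (\<phi> w - \<phi> v) \<le> real j" "norm (\<phi> u - \<phi> w) \<le> 1"
    using Suc.IH Suc.prems uc by blast+
  then have "norm ((\<phi> w - \<phi> v) + (\<phi> u - \<phi> w)) \<le> real j + 1" by norm
  then show ?case by (simp add: algebra_simps)
qed simp

section \<open>Passage to the limit: setting and convergence of the right-hand side\<close>

text \<open>Almost periodicity enters only through limits along \<sigma>. \<open>f_shift\<close> and
  \<open>\<xi>_shift\<close> supply just one good point in each short window, eventually in
  \<open>n\<close>. Left continuity of \<open>p\<close> is the regularity that matches them: good
  points can be picked to the left of a given point.\<close>

locale translated_bounded_solution =
  fixes tk :: "int \<Rightarrow> real" and h :: real
    and f :: "real \<Rightarrow> 'a::banach \<Rightarrow> 'a \<Rightarrow> 'a" and I :: "int \<Rightarrow> 'a \<Rightarrow> 'a"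
    and \<xi> p :: "real \<Rightarrow> 'a" and B L :: real
    and \<sigma> :: "nat \<Rightarrow> real" and m :: "nat \<Rightarrow> int"
  assumes tk: "disc_seq tk"
    and f_ucont: "\<And>\<epsilon>. \<epsilon> > 0 \<Longrightarrow> \<exists>\<delta>>0. \<forall>x\<in>cball 0 B. \<forall>y\<in>cball 0 B. \<forall>t' t''.
      same_interval tk t' t'' \<and> \<bar>t' - t''\<bar> < \<delta> \<longrightarrow> norm (f t' x y - f t'' x y) < \<epsilon>"
    and f_lip: "\<And>t x x' y y'. x \<in> cball 0 B \<Longrightarrow> x' \<in> cball 0 B \<Longrightarrow> y \<in> cball 0 B \<Longrightarrow> y' \<in> cball 0 B \<Longrightarrow>
      norm (f t x y - f t x' y') \<le> L * (norm (x - x') + norm (y - y'))"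
    and I_cont: "\<And>k x. isCont (I k) x"
    and sol: "impulsive_solution tk h f I {0..} \<xi>"
    and bounded: "\<And>t. t \<ge> 0 \<Longrightarrow> \<xi> t \<in> cball 0 B"
    and p_left: "\<And>u. continuous (at u within {..u}) p"
    and \<sigma>_top: "filterlim \<sigma> at_top sequentially"
    and tk_shift: "\<And>k. (\<lambda>n. tk (k + m n) - \<sigma> n) \<longlonglongrightarrow> tk k"
    and I_shift: "\<And>k \<eta>. \<eta> > 0 \<Longrightarrow> \<forall>\<^sub>F n in sequentially. \<forall>x\<in>cball 0 B. norm (I (k + m n) x - I k x) < \<eta>"
    and f_shift: "\<And>u \<delta> \<eta>. \<delta> > 0 \<Longrightarrow> \<eta> > 0 \<Longrightarrow> \<forall>\<^sub>F n in sequentially. \<exists>u'\<in>{u..u+\<delta>}. \<exists>e. \<bar>e\<bar> < \<eta> \<and>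
      (\<forall>x\<in>cball 0 B. \<forall>y\<in>cball 0 B. norm (f (u' + \<sigma> n) x y - f (u' + e) x y) < \<eta>)"
    and \<xi>_shift: "\<And>u \<delta> \<eta>. \<delta> > 0 \<Longrightarrow> \<eta> > 0 \<Longrightarrow> \<forall>\<^sub>F n in sequentially. \<exists>u'\<in>{u..u+\<delta>}. \<exists>e. \<bar>e\<bar> < \<eta> \<and>
      norm (\<xi> (u' + \<sigma> n) - p (u' + e)) < \<eta>"
begin

lemma zero_in_ball: "0 \<in> cball (0::'a) B"
  using bounded[of 0] order_trans[OF norm_ge_zero[of "\<xi> 0"], of B] by simp

lemma eventually_shift_gt: "tk k < u \<Longrightarrow> \<forall>\<^sub>F n in sequentially. tk (k + m n) < u + \<sigma> n"
  using order_tendstoD(2)[OF tk_shift] by (auto elim!: eventually_mono simp: algebra_simps)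

lemma eventually_shift_lt: "u < tk k \<Longrightarrow> \<forall>\<^sub>F n in sequentially. u + \<sigma> n < tk (k + m n)"
  using order_tendstoD(1)[OF tk_shift] by (auto elim!: eventually_mono simp: algebra_simps)

lemma eventually_\<sigma>_ge: "\<forall>\<^sub>F n in sequentially. c \<le> \<sigma> n"
  using \<sigma>_top by (simp add: filterlim_at_top)

lemma same_interval_tk:
  "tk k < u \<Longrightarrow> u \<le> tk (k + 1) \<Longrightarrow> tk k < v \<Longrightarrow> v \<le> tk (k + 1) \<Longrightarrow> same_interval tk u v"
  by (auto simp: same_interval_def)

lemma same_interval_shift:
  "tk (k + m n) < u \<Longrightarrow> u \<le> tk (k + 1 + m n) \<Longrightarrow> tk (k + m n) < v \<Longrightarrow> v \<le> tk (k + 1 + m n)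
    \<Longrightarrow> same_interval tk u v"
  using same_interval_tk[of "k + m n" u v] by (simp add: algebra_simps)

text \<open>A good point \<open>u'\<close> close to \<open>u\<close> gives closeness there; uniform
  continuity carries it back to \<open>u\<close>, once in the shifted interval and once in the
  original one.\<close>

lemma f_tendsto:
  assumes "tk k < u" "u < tk (k + 1)" "\<eta> > 0"
  shows "\<forall>\<^sub>F n in sequentially. \<forall>x\<in>cball 0 B. \<forall>y\<in>cball 0 B. norm (f (u + \<sigma> n) x y - f u x y) < \<eta>"
proof -
  obtain d where d: "d > 0" "\<And>x y t' t''. x \<in> cball 0 B \<Longrightarrow> y \<in> cball 0 B \<Longrightarrow>
      same_interval tk t' t'' \<Longrightarrow> \<bar>t' - t''\<bar> < d \<Longrightarrow> norm (f t' x y - f t'' x y) < \<eta> / 3"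
    using f_ucont[of "\<eta> / 3"] \<open>\<eta> > 0\<close> by auto
  \<comment> \<open>The quarter keeps \<open>u' + e\<close>, which is less than
    \<open>2 * \<delta>\<close> away from \<open>u\<close>, in the interval and within
    \<open>d\<close> of \<open>u\<close>.\<close>
  define \<delta> where "\<delta> = Min {d, u - tk k, tk (k + 1) - u} / 4"
  have "\<delta> > 0" "4 * \<delta> \<le> d" "4 * \<delta> \<le> u - tk k" "4 * \<delta> \<le> tk (k + 1) - u"
    using d(1) assms by (auto simp: \<delta>_def)
  note \<delta> = this
  have "\<forall>\<^sub>F n in sequentially. \<exists>u'\<in>{u..u+\<delta>}. \<exists>e. \<bar>e\<bar> < min \<delta> (\<eta> / 3) \<and>
      (\<forall>x\<in>cball 0 B. \<forall>y\<in>cball 0 B. norm (f (u' + \<sigma> n) x y - f (u' + e) x y) < min \<delta> (\<eta> / 3))"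
    using \<delta> \<open>\<eta> > 0\<close> by (intro f_shift) auto
  moreover have "\<forall>\<^sub>F n in sequentially. tk (k + m n) < u + \<sigma> n"
    using assms by (intro eventually_shift_gt)
  moreover have "\<forall>\<^sub>F n in sequentially. (u + \<delta>) + \<sigma> n < tk (k + 1 + m n)"
    using \<delta> by (intro eventually_shift_lt) auto
  ultimately show ?thesis
  proof eventually_elim
    case (elim n)
    then obtain u' e where u': "u \<le> u'" "u' \<le> u + \<delta>" "\<bar>e\<bar> < \<delta>"
      "\<And>x y. x \<in> cball 0 B \<Longrightarrow> y \<in> cball 0 B \<Longrightarrow> norm (f (u' + \<sigma> n) x y - f (u' + e) x y) < \<eta> / 3"
      by auto
    have 1: "same_interval tk (u + \<sigma> n) (u' + \<sigma> n)"
      using elim u' \<delta> by (intro same_interval_shift[of k n]) auto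
    have 2: "same_interval tk (u' + e) u"
      using u' \<delta> by (intro same_interval_tk[of k]) auto
    show ?case
    proof (intro ballI)
      fix x y :: 'a assume xy: "x \<in> cball 0 B" "y \<in> cball 0 B"
      have "norm (f (u + \<sigma> n) x y - f (u' + \<sigma> n) x y) < \<eta> / 3"
        using u' \<delta> by (intro d(2)[OF xy 1]) auto
      moreover have "norm (f (u' + e) x y - f u x y) < \<eta> / 3"
        using u' \<delta> by (intro d(2)[OF xy 2]) auto
      ultimately show "norm (f (u + \<sigma> n) x y - f u x y) < \<eta>"
        using u'(4)[OF xy] by norm
    qed
  qed
qed

text \<open>The bound depends on \<open>k\<close>: gaps of \<open>tk\<close> may be arbitrarily small, and then \<open>f\<close> need not be
  bounded on \<open>\<real> \<times> K \<times> K\<close>.\<close>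
lemma f_bounded_on_shifted_interval:
  obtains M where "M \<ge> 0" "\<forall>\<^sub>F n in sequentially. \<forall>v. tk (k + m n) < v \<and> v \<le> tk (k + 1 + m n) \<longrightarrow>
    (\<forall>x\<in>cball 0 B. \<forall>y\<in>cball 0 B. norm (f v x y) \<le> M)"
proof -
  have lt: "tk k < tk (k + 1)" using tk by (simp add: disc_seq_def strict_mono_def)
  obtain \<delta> where \<delta>: "\<delta> > 0" "\<And>x y t' t''. x \<in> cball 0 B \<Longrightarrow> y \<in> cball 0 B \<Longrightarrow>
      same_interval tk t' t'' \<Longrightarrow> \<bar>t' - t''\<bar> < \<delta> \<Longrightarrow> norm (f t' x y - f t'' x y) < 1"
    using f_ucont[of 1] by auto
  define c where "c = (tk k + tk (k + 1)) / 2"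
  have c: "tk k < c" "c < tk (k + 1)" using lt by (auto simp: c_def)
  \<comment> \<open>Enough steps to cross the shifted interval: its length converges to that of the
    original one, and the extra 1 absorbs the deviation.\<close>
  obtain j :: nat where j: "tk (k + 1) - tk k + 1 < real j * (\<delta> / 2)"
    using reals_Archimedean3[of "\<delta> / 2"] \<delta>(1) half_gt_zero by blast
  have M0: "norm (f c x y) \<le> norm (f c 0 0) + \<bar>L\<bar> * (B + B)"
    if "x \<in> cball 0 B" "y \<in> cball 0 B" for x y
  proof -
    have "norm (f c x y - f c 0 0) \<le> L * (norm (x - 0) + norm (y - 0))"
      using that zero_in_ball by (intro f_lip)
    also have "\<dots> \<le> \<bar>L\<bar> * (B + B)"
      using that by (intro mult_mono add_mono) auto
    finally show ?thesis by norm
  qed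
  have B: "B \<ge> 0" using zero_in_ball by simp
  show thesis
  proof
    show "0 \<le> norm (f c 0 0) + \<bar>L\<bar> * (B + B) + 1 + real j"
      using B by simp
    have len: "(\<lambda>n. (tk (k + 1 + m n) - \<sigma> n) - (tk (k + m n) - \<sigma> n)) \<longlonglongrightarrow> tk (k + 1) - tk k"
      by (intro tendsto_intros tk_shift)
    have "\<forall>\<^sub>F n in sequentially. (tk (k + 1 + m n) - \<sigma> n) - (tk (k + m n) - \<sigma> n) < tk (k + 1) - tk k + 1"
      by (rule order_tendstoD(2)[OF len]) simp
    with eventually_shift_gt[OF c(1)] eventually_shift_lt[OF c(2)]
      f_tendsto[OF c zero_less_one]
    show "\<forall>\<^sub>F n in sequentially. \<forall>v. tk (k + m n) < v \<and> v \<le> tk (k + 1 + m n) \<longrightarrow>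
      (\<forall>x\<in>cball 0 B. \<forall>y\<in>cball 0 B. norm (f v x y) \<le> norm (f c 0 0) + \<bar>L\<bar> * (B + B) + 1 + real j)"
    proof eventually_elim
      case (elim n)
      show ?case
      proof (intro allI impI ballI)
        fix v x y assume v: "tk (k + m n) < v \<and> v \<le> tk (k + 1 + m n)"
          and xy: "x \<in> cball (0::'a) B" "y \<in> cball (0::'a) B"
        have "norm (f v x y - f (c + \<sigma> n) x y) \<le> real j"
        proof (rule norm_diff_le_steps[where a = "tk (k + m n)" and b = "tk (k + 1 + m n)" and \<delta> = \<delta>])
          fix u v assume "u \<in> {tk (k + m n)<..tk (k + 1 + m n)}" "v \<in> {tk (k + m n)<..tk (k + 1 + m n)}"
            "\<bar>u - v\<bar> < \<delta>"
          then show "norm (f u x y - f v x y) \<le> 1"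
            using \<delta>(2)[OF xy same_interval_shift[of k n u v]] by (auto intro: less_imp_le)
        next
          show "\<bar>v - (c + \<sigma> n)\<bar> \<le> real j * (\<delta> / 2)"
            using elim v j by linarith
        qed (use \<delta> v elim in auto)
        moreover have "norm (f (c + \<sigma> n) x y - f c x y) < 1" using elim xy by blast
        ultimately show "norm (f v x y) \<le> norm (f c 0 0) + \<bar>L\<bar> * (B + B) + 1 + real j"
          using M0[OF xy] by norm
      qed
    qed
  qed
qed

section \<open>Equicontinuity and convergence of the translates\<close>

lemma \<xi>_increment_le:
  assumes "tk k < a" "a \<le> b" "b \<le> tk (k + 1)" "0 \<le> a" "0 \<le> M"
    and bd: "\<And>v. a < v \<Longrightarrow> v < b \<Longrightarrow> norm (f v (\<xi> v) (\<xi> (v - h)) - c) \<le> M"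
  shows "norm (\<xi> b - \<xi> a - (b - a) *\<^sub>R c) \<le> M * (b - a)"
proof -
  have mono: "strict_mono tk" using tk by (simp add: disc_seq_def)
  have notin: "v \<notin> range tk" if "a \<le> v" "v < tk (k + 1)" for v
  proof
    assume "v \<in> range tk"
    then obtain i where "v = tk i" by auto
    with that assms have "tk k < tk i" "tk i < tk (k + 1)" by auto
    then show False by (simp add: strict_mono_less[OF mono])
  qed
  have "continuous_on {a..b} \<xi>"
    unfolding continuous_on_eq_continuous_within
  proof
    fix v assume v: "v \<in> {a..b}"
    show "continuous (at v within {a..b}) \<xi>"
    \<comment> \<open>At an impulse only left continuity is known; this suffices since
      \<open>b\<close> does not exceed \<open>tk (k + 1)\<close>.\<close>
    proof (cases "v = tk (k + 1)")
      case True
      then have "continuous (at v within ({0..} \<inter> {..v})) \<xi>"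
        using sol v assms unfolding impulsive_solution_def by auto
      then show ?thesis
        by (rule continuous_within_subset) (use True v assms in auto)
    next
      case False
      then have "continuous (at v within {0..}) \<xi>"
        using sol v assms notin[of v] unfolding impulsive_solution_def by auto
      then show ?thesis
        by (rule continuous_within_subset) (use assms in auto)
    qed
  qed
  moreover define S where "S = (\<lambda>t. t + h) ` {t \<in> range tk. a - h \<le> t \<and> t \<le> b - h}"
  have "finite S" unfolding S_def by (intro finite_imageI disc_seq_finite tk)
  moreover have "(\<xi> has_vector_derivative f v (\<xi> v) (\<xi> (v - h))) (at v)" if v: "v \<in> {a<..<b} - S" for v
  proof -
    have "v - h \<notin> range tk"
    proof
      assume "v - h \<in> range tk"
      then have "v - h + h \<in> S" using v unfolding S_def by (intro imageI) auto
      then show False using v by simp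
    qed
    then have "(\<xi> has_vector_derivative f v (\<xi> v) (\<xi> (v - h))) (at v within {0..})"
      using sol v assms notin[of v] unfolding impulsive_solution_def by auto
    moreover have "at v within {0..} = at v"
      using v assms by (intro at_within_open_subset[of _ "{0<..}"]) auto
    ultimately show ?thesis by simp
  qed
  ultimately show ?thesis
    using assms by (intro norm_increment_le[of S]) auto
qed

lemma \<xi>_equilipschitz:
  obtains M where "M \<ge> 0" "\<forall>\<^sub>F n in sequentially. \<forall>a b. tk (k + m n) < a \<and> a \<le> b \<and> b \<le> tk (k + 1 + m n) \<longrightarrow>
    norm (\<xi> b - \<xi> a) \<le> M * (b - a)"
proof -
  obtain M where M: "M \<ge> 0" "\<forall>\<^sub>F n in sequentially. \<forall>v. tk (k + m n) < v \<and> v \<le> tk (k + 1 + m n) \<longrightarrow>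
    (\<forall>x\<in>cball 0 B. \<forall>y\<in>cball 0 B. norm (f v x y) \<le> M)"
    using f_bounded_on_shifted_interval by blast
  \<comment> \<open>The shift must be so large that \<open>v - h\<close> is nonnegative too: the
    bound \<open>B\<close> does not cover the initial function.\<close>
  have "\<forall>\<^sub>F n in sequentially. \<bar>h\<bar> - (tk k - 1) \<le> \<sigma> n" by (rule eventually_\<sigma>_ge)
  moreover have "\<forall>\<^sub>F n in sequentially. (tk k - 1) + \<sigma> n < tk (k + m n)"
    by (rule eventually_shift_lt) simp
  ultimately have "\<forall>\<^sub>F n in sequentially. \<forall>a b. tk (k + m n) < a \<and> a \<le> b \<and> b \<le> tk (k + 1 + m n) \<longrightarrow>
    norm (\<xi> b - \<xi> a) \<le> M * (b - a)"
    using M(2)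
  proof eventually_elim
    case (elim n)
    show ?case
    proof (intro allI impI)
      fix a b assume ab: "tk (k + m n) < a \<and> a \<le> b \<and> b \<le> tk (k + 1 + m n)"
      have "norm (\<xi> b - \<xi> a - (b - a) *\<^sub>R 0) \<le> M * (b - a)"
      proof (rule \<xi>_increment_le[where k = "k + m n"])
        fix v assume v: "a < v" "v < b"
        have "0 \<le> v" "0 \<le> v - h" using v ab elim(1,2) by auto
        then have "\<xi> v \<in> cball 0 B" "\<xi> (v - h) \<in> cball 0 B" by (simp_all only: bounded)
        then show "norm (f v (\<xi> v) (\<xi> (v - h)) - 0) \<le> M"
          using elim(3) v ab by auto
      qed (use ab elim M(1) in \<open>auto simp: algebra_simps\<close>)
      then show "norm (\<xi> b - \<xi> a) \<le> M * (b - a)" by simp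
    qed
  qed
  with M(1) that show thesis by blast
qed

text \<open>Moving points \<open>v n\<close> are allowed so that the result also applies at impulse
  times, with \<open>u\<close> a right endpoint. A good point to the left of \<open>u\<close> is
  inside the interval and sees \<open>p\<close> close to \<open>p u\<close> by left continuity; the
  common Lipschitz constant carries the estimate on to \<open>v n\<close>.\<close>

lemma \<xi>_tendsto:
  assumes u: "tk k < u" "u \<le> tk (k + 1)"
    and v: "\<forall>\<^sub>F n in sequentially. tk (k + m n) < v n \<and> v n \<le> tk (k + 1 + m n)"
    and lim: "(\<lambda>n. v n - \<sigma> n) \<longlonglongrightarrow> u"
  shows "(\<lambda>n. \<xi> (v n)) \<longlonglongrightarrow> p u"
proof (rule tendstoI)
  fix \<eta> :: real assume "\<eta> > 0"
  obtain M where M: "M \<ge> 0" "\<forall>\<^sub>F n in sequentially. \<forall>a b. tk (k + m n) < a \<and> a \<le> b \<and> b \<le> tk (k + 1 + m n) \<longrightarrow>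
    norm (\<xi> b - \<xi> a) \<le> M * (b - a)"
    using \<xi>_equilipschitz by blast
  obtain d where d: "d > 0" "\<And>w. w \<le> u \<Longrightarrow> \<bar>w - u\<bar> < d \<Longrightarrow> norm (p w - p u) < \<eta> / 3"
    using p_left[of u] \<open>\<eta> > 0\<close> unfolding continuous_within_eps_delta
    by (auto simp: dist_norm elim!: allE[of _ "\<eta> / 3"])
  \<comment> \<open>The good point is sought between \<open>u - 2 * \<delta>\<close> and
    \<open>u - \<delta>\<close>, so it precedes \<open>v n\<close> by at most
    \<open>3 * \<delta>\<close>. The \<open>M + 1\<close> avoids division by zero.\<close>
  define \<delta> where "\<delta> = Min {d, u - tk k, \<eta> / (3 * (M + 1))} / 4"
  have \<delta>: "\<delta> > 0" "4 * \<delta> \<le> d" "4 * \<delta> \<le> u - tk k" "4 * \<delta> \<le> \<eta> / (3 * (M + 1))"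
    using d(1) u M(1) \<open>\<eta> > 0\<close> by (auto simp: \<delta>_def)
  have "(M + 1) * (4 * \<delta>) \<le> \<eta> / 3"
    using \<delta>(4) M(1) by (simp add: field_simps)
  then have M\<delta>: "M * (3 * \<delta>) \<le> \<eta> / 3"
    using mult_mono[of M "M + 1" "3 * \<delta>" "4 * \<delta>"] M(1) \<delta>(1) by linarith
  have "\<forall>\<^sub>F n in sequentially. \<exists>u'\<in>{u - 2 * \<delta>..u - 2 * \<delta> + \<delta>}. \<exists>e. \<bar>e\<bar> < min \<delta> (\<eta> / 3) \<and>
      norm (\<xi> (u' + \<sigma> n) - p (u' + e)) < min \<delta> (\<eta> / 3)"
    using \<delta> \<open>\<eta> > 0\<close> by (intro \<xi>_shift) auto
  moreover have "\<forall>\<^sub>F n in sequentially. tk (k + m n) < (u - 2 * \<delta>) + \<sigma> n"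
    using \<delta> by (intro eventually_shift_gt) auto
  moreover have "\<forall>\<^sub>F n in sequentially. (u - \<delta>) + \<sigma> n < tk (k + 1 + m n)"
    using \<delta> u by (intro eventually_shift_lt) auto
  moreover have "\<forall>\<^sub>F n in sequentially. \<bar>v n - \<sigma> n - u\<bar> < \<delta>"
    using tendstoD[OF lim \<delta>(1)] by (simp add: dist_real_def)
  ultimately show "\<forall>\<^sub>F n in sequentially. dist (\<xi> (v n)) (p u) < \<eta>"
    using M(2) v
  proof eventually_elim
    case (elim n)
    then obtain u' e where u': "u - 2 * \<delta> \<le> u'" "u' \<le> u - \<delta>" "\<bar>e\<bar> < \<delta>"
      "norm (\<xi> (u' + \<sigma> n) - p (u' + e)) < \<eta> / 3"
      by auto
    have "norm (p (u' + e) - p u) < \<eta> / 3"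
      using u' \<delta> by (intro d(2)) auto
    moreover have "norm (\<xi> (v n) - \<xi> (u' + \<sigma> n)) \<le> M * (v n - (u' + \<sigma> n))"
      using elim u' \<delta> by (intro elim(5)[rule_format]) auto
    moreover have "M * (v n - (u' + \<sigma> n)) \<le> M * (3 * \<delta>)"
      using elim u' M(1) by (intro mult_left_mono) auto
    ultimately have "norm (\<xi> (v n) - \<xi> (u' + \<sigma> n)) \<le> \<eta> / 3" "norm (p (u' + e) - p u) < \<eta> / 3"
      using M\<delta> by linarith+
    then show ?case
      using u'(4) unfolding dist_norm by norm
  qed
qed

lemma \<xi>_tendsto_translate:
  assumes "tk k < u" "u < tk (k + 1)"
  shows "(\<lambda>n. \<xi> (u + \<sigma> n)) \<longlonglongrightarrow> p u"
proof (rule \<xi>_tendsto[of k])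
  show "\<forall>\<^sub>F n in sequentially. tk (k + m n) < u + \<sigma> n \<and> u + \<sigma> n \<le> tk (k + 1 + m n)"
    using eventually_shift_gt[OF assms(1)] eventually_shift_lt[OF assms(2)]
    by eventually_elim auto
qed (use assms in auto)

section \<open>Continuity and jumps of the limit\<close>

lemma p_lipschitz:
  obtains M where "M \<ge> 0" "\<And>a b. tk k < a \<Longrightarrow> a \<le> b \<Longrightarrow> b < tk (k + 1) \<Longrightarrow> norm (p b - p a) \<le> M * (b - a)"
proof -
  obtain M where M: "M \<ge> 0" "\<forall>\<^sub>F n in sequentially. \<forall>a b. tk (k + m n) < a \<and> a \<le> b \<and> b \<le> tk (k + 1 + m n) \<longrightarrow>
    norm (\<xi> b - \<xi> a) \<le> M * (b - a)"
    using \<xi>_equilipschitz by blast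
  show thesis
  proof (rule that[OF M(1)])
    fix a b assume ab: "tk k < a" "a \<le> b" "b < tk (k + 1)"
    have lim: "(\<lambda>n. norm (\<xi> (b + \<sigma> n) - \<xi> (a + \<sigma> n))) \<longlonglongrightarrow> norm (p b - p a)"
      using ab by (intro tendsto_intros \<xi>_tendsto_translate[of k]) auto
    have "\<forall>\<^sub>F n in sequentially. norm (\<xi> (b + \<sigma> n) - \<xi> (a + \<sigma> n)) \<le> M * (b - a)"
      using M(2) eventually_shift_gt[OF ab(1)] eventually_shift_lt[OF ab(3)]
    proof eventually_elim
      case (elim n)
      then have "norm (\<xi> (b + \<sigma> n) - \<xi> (a + \<sigma> n)) \<le> M * ((b + \<sigma> n) - (a + \<sigma> n))"
        using ab by (intro elim(1)[rule_format]) auto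
      then show ?case by simp
    qed
    then show "norm (p b - p a) \<le> M * (b - a)"
      by (rule tendsto_upperbound[OF lim]) simp
  qed
qed

text \<open>Two-sided continuity is not among the assumptions on \<open>p\<close>; it is inherited
  from the Lipschitz bound common to the translates.\<close>

lemma p_continuous:
  assumes "u \<notin> range tk"
  shows "isCont p u"
proof -
  obtain k where k: "tk k < u" "u \<le> tk (k + 1)" using disc_seq_interval[OF tk] by blast
  with assms have k': "u < tk (k + 1)" by (metis order_le_less rangeI)
  obtain M where M: "M \<ge> 0" "\<And>a b. tk k < a \<Longrightarrow> a \<le> b \<Longrightarrow> b < tk (k + 1) \<Longrightarrow> norm (p b - p a) \<le> M * (b - a)"
    using p_lipschitz by blast
  have "M-lipschitz_on {tk k<..<tk (k + 1)} p"
  proof (rule lipschitz_onI)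
    fix a b assume "a \<in> {tk k<..<tk (k + 1)}" "b \<in> {tk k<..<tk (k + 1)}"
    then show "dist (p a) (p b) \<le> M * dist a b"
      using M(2)[of a b] M(2)[of b a]
      by (cases "a \<le> b") (auto simp: dist_norm norm_minus_commute)
  qed (rule M(1))
  then have "continuous_on {tk k<..<tk (k + 1)} p" by (rule lipschitz_on_continuous_on)
  then show ?thesis using k k' by (simp add: continuous_on_eq_continuous_at)
qed

lemma \<xi>_tendsto_impulse: "(\<lambda>n. \<xi> (tk (k + m n))) \<longlonglongrightarrow> p (tk k)"
proof -
  \<comment> \<open>An impulse time is the right endpoint of the preceding interval, hence the index
    \<open>k - 1\<close>.\<close>
  have "(\<lambda>n. \<xi> (tk (k - 1 + 1 + m n))) \<longlonglongrightarrow> p (tk (k - 1 + 1))"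
  proof (rule \<xi>_tendsto[of "k - 1"])
    show "\<forall>\<^sub>F n in sequentially. tk (k - 1 + m n) < tk (k - 1 + 1 + m n) \<and> tk (k - 1 + 1 + m n) \<le> tk (k - 1 + 1 + m n)"
      using tk by (simp add: disc_seq_def strict_mono_def)
  qed (use tk tk_shift[of k] in \<open>auto simp: disc_seq_def strict_mono_def\<close>)
  then show ?thesis by simp
qed

text \<open>The limits \<open>n\<close> to infinity and \<open>u\<close> down to \<open>tk k\<close>
  may be exchanged because the Lipschitz constant to the right of the shifted impulses does not
  depend on \<open>n\<close>.\<close>

lemma p_jump: "(p \<longlongrightarrow> p (tk k) + I k (p (tk k))) (at_right (tk k))"
proof -
  have lt: "tk i < tk (i + 1)" for i using tk by (simp add: disc_seq_def strict_mono_def)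
  obtain M where M: "M \<ge> 0" "\<forall>\<^sub>F n in sequentially. \<forall>a b. tk (k + m n) < a \<and> a \<le> b \<and> b \<le> tk (k + 1 + m n) \<longrightarrow>
    norm (\<xi> b - \<xi> a) \<le> M * (b - a)"
    using \<xi>_equilipschitz by blast
  have pos: "\<forall>\<^sub>F n in sequentially. 0 \<le> tk (k + m n)"
    using eventually_shift_lt[of "tk k - 1" k, simplified] eventually_\<sigma>_ge[of "1 - tk k"]
    by eventually_elim auto
  \<comment> \<open>The argument varies with \<open>n\<close>, so convergence of the impulse maps
    has to be uniform on the ball.\<close>
  have "(\<lambda>n. norm (I (k + m n) (\<xi> (tk (k + m n))) - I k (\<xi> (tk (k + m n))))) \<longlonglongrightarrow> 0"
  proof (rule tendstoI)
    fix \<eta> :: real assume "\<eta> > 0"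
    from I_shift[OF this, of k] pos
    show "\<forall>\<^sub>F n in sequentially. dist (norm (I (k + m n) (\<xi> (tk (k + m n))) - I k (\<xi> (tk (k + m n))))) 0 < \<eta>"
    proof eventually_elim
      case (elim n)
      then show ?case using bounded[OF elim(2)] by auto
    qed
  qed
  then have "(\<lambda>n. I (k + m n) (\<xi> (tk (k + m n))) - I k (\<xi> (tk (k + m n)))) \<longlonglongrightarrow> 0"
    by (rule tendsto_norm_zero_cancel)
  moreover have "(\<lambda>n. I k (\<xi> (tk (k + m n)))) \<longlonglongrightarrow> I k (p (tk k))"
    by (rule isCont_tendsto_compose[OF I_cont \<xi>_tendsto_impulse])
  ultimately have "(\<lambda>n. (I (k + m n) (\<xi> (tk (k + m n))) - I k (\<xi> (tk (k + m n)))) + I k (\<xi> (tk (k + m n))))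
      \<longlonglongrightarrow> 0 + I k (p (tk k))"
    by (rule tendsto_add)
  then have I_lim: "(\<lambda>n. I (k + m n) (\<xi> (tk (k + m n)))) \<longlonglongrightarrow> I k (p (tk k))" by simp
  have bound: "norm (p u - (p (tk k) + I k (p (tk k)))) \<le> M * (u - tk k)"
    if u: "tk k < u" "u < tk (k + 1)" for u
  proof (rule tendsto_le[OF sequentially_bot])
    show "(\<lambda>n. norm (\<xi> (u + \<sigma> n) - (\<xi> (tk (k + m n)) + I (k + m n) (\<xi> (tk (k + m n))))))
        \<longlonglongrightarrow> norm (p u - (p (tk k) + I k (p (tk k))))"
      by (intro tendsto_intros \<xi>_tendsto_translate[OF u] \<xi>_tendsto_impulse I_lim)
    show "(\<lambda>n. M * (u - (tk (k + m n) - \<sigma> n))) \<longlonglongrightarrow> M * (u - tk k)"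
      by (intro tendsto_intros tk_shift)
    show "\<forall>\<^sub>F n in sequentially. norm (\<xi> (u + \<sigma> n) - (\<xi> (tk (k + m n)) + I (k + m n) (\<xi> (tk (k + m n)))))
        \<le> M * (u - (tk (k + m n) - \<sigma> n))"
      using M(2) pos eventually_shift_gt[OF u(1)] eventually_shift_lt[OF u(2)]
    proof eventually_elim
      case (elim n)
      let ?T = "tk (k + m n)"
      have jump: "(\<xi> \<longlongrightarrow> \<xi> ?T + I (k + m n) (\<xi> ?T)) (at_right ?T)"
        using sol elim(2) unfolding impulsive_solution_def by auto
      \<comment> \<open>For fixed \<open>n\<close>, the left end of the Lipschitz estimate tends to
        the impulse from the right, where \<xi> has its jump value as limit.\<close>
      have "norm (\<xi> (u + \<sigma> n) - (\<xi> ?T + I (k + m n) (\<xi> ?T))) \<le> M * (u + \<sigma> n - ?T)"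
      proof (rule tendsto_le[OF trivial_limit_at_right_real])
        show "((\<lambda>a. norm (\<xi> (u + \<sigma> n) - \<xi> a)) \<longlongrightarrow> norm (\<xi> (u + \<sigma> n) - (\<xi> ?T + I (k + m n) (\<xi> ?T)))) (at_right ?T)"
          by (intro tendsto_intros jump)
        show "((\<lambda>a. M * (u + \<sigma> n - a)) \<longlongrightarrow> M * (u + \<sigma> n - ?T)) (at_right ?T)"
          by (intro tendsto_intros)
        show "\<forall>\<^sub>F a in at_right ?T. norm (\<xi> (u + \<sigma> n) - \<xi> a) \<le> M * (u + \<sigma> n - a)"
          using eventually_at_right_less[of ?T] eventually_at_right_real[OF elim(3)]
        proof eventually_elim
          case (elim a)
          with \<open>u + \<sigma> n < tk (k + 1 + m n)\<close> show ?case
            by (intro \<open>\<forall>a b. tk (k + m n) < a \<and> a \<le> b \<and> b \<le> tk (k + 1 + m n) \<longrightarrow>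
              norm (\<xi> b - \<xi> a) \<le> M * (b - a)\<close>[rule_format]) auto
        qed
      qed
      then show ?case by (simp add: algebra_simps)
    qed
  qed
  have "((\<lambda>u. p u - (p (tk k) + I k (p (tk k)))) \<longlongrightarrow> 0) (at_right (tk k))"
  proof (rule Lim_null_comparison)
    show "\<forall>\<^sub>F u in at_right (tk k). norm (p u - (p (tk k) + I k (p (tk k)))) \<le> M * (u - tk k)"
      using eventually_at_right_real[OF lt[of k]] by eventually_elim (auto intro: bound)
    have "((\<lambda>u. M * (u - tk k)) \<longlongrightarrow> M * (tk k - tk k)) (at_right (tk k))"
      by (intro tendsto_intros)
    then show "((\<lambda>u. M * (u - tk k)) \<longlongrightarrow> 0) (at_right (tk k))" by simp
  qed
  then show ?thesis by (rule LIM_zero_cancel)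
qed

section \<open>The differential equation for the limit\<close>

text \<open>No convergence of derivatives is needed: near \<open>t\<close> the increments of the
  translates are eventually within \<open>\<eta> * (b - a)\<close> of
  \<open>(b - a) *\<^sub>R c\<close>, and this inequality survives the pointwise limit.\<close>

lemma p_derivative:
  assumes "t \<notin> range tk" "t - h \<notin> range tk"
  shows "(p has_vector_derivative f t (p t) (p (t - h))) (at t)"
proof -
  obtain k where k: "tk k < t" "t < tk (k + 1)"
    using disc_seq_interval[OF tk] assms(1) by (metis order_le_less rangeI)
  obtain j where j: "tk j < t - h" "t - h < tk (j + 1)"
    using disc_seq_interval[OF tk] assms(2) by (metis order_le_less rangeI)
  have in_ball: "p w \<in> cball 0 B" if "tk i < w" "w < tk (i + 1)" for i w
  proof (rule Lim_in_closed_set[OF closed_cball _ sequentially_bot \<xi>_tendsto_translate[OF that]])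
    show "\<forall>\<^sub>F n in sequentially. \<xi> (w + \<sigma> n) \<in> cball 0 B"
      using eventually_\<sigma>_ge[of "- w"] by eventually_elim (intro bounded, simp)
  qed
  define c where "c = f t (p t) (p (t - h))"
  obtain M where M: "M \<ge> 0" "\<forall>\<^sub>F n in sequentially. \<forall>a b. tk (k + m n) < a \<and> a \<le> b \<and> b \<le> tk (k + 1 + m n) \<longrightarrow>
    norm (\<xi> b - \<xi> a) \<le> M * (b - a)"
    using \<xi>_equilipschitz by blast
  \<comment> \<open>The delayed argument runs in another interval, with its own constant.\<close>
  obtain M' where M': "M' \<ge> 0" "\<forall>\<^sub>F n in sequentially. \<forall>a b. tk (j + m n) < a \<and> a \<le> b \<and> b \<le> tk (j + 1 + m n) \<longrightarrow>
    norm (\<xi> b - \<xi> a) \<le> M' * (b - a)"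
    using \<xi>_equilipschitz by blast
  have main: "\<exists>\<rho>>0. \<forall>a b. t - \<rho> < a \<and> a \<le> b \<and> b < t + \<rho> \<longrightarrow> norm (p b - p a - (b - a) *\<^sub>R c) \<le> \<eta> * (b - a)"
    if "\<eta> > 0" for \<eta>
  proof -
    obtain d where d: "d > 0" "\<And>x y t' t''. x \<in> cball 0 B \<Longrightarrow> y \<in> cball 0 B \<Longrightarrow>
        same_interval tk t' t'' \<Longrightarrow> \<bar>t' - t''\<bar> < d \<Longrightarrow> norm (f t' x y - f t'' x y) < \<eta> / 3"
      using f_ucont[of "\<eta> / 3"] \<open>\<eta> > 0\<close> by auto
    \<comment> \<open>Bounds the Lipschitz contribution by \<open>A * \<rho>\<close>: each of the
      two arguments deviates by at most \<open>M * \<rho> + \<rho>\<close> or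
      \<open>M' * \<rho> + \<rho>\<close>. The added 1 keeps \<open>A\<close> positive.\<close>
    define A where "A = \<bar>L\<bar> * (M + M' + 2) + 1"
    have A: "A > 0" using M(1) M'(1) by (simp add: A_def add_nonneg_pos)
    define \<rho> where "\<rho> = Min {d, t - tk k, tk (k + 1) - t, t - h - tk j, tk (j + 1) - (t - h), \<eta> / (3 * A)} / 2"
    have "\<rho> > 0" "2 * \<rho> \<le> d" "2 * \<rho> \<le> t - tk k" "2 * \<rho> \<le> tk (k + 1) - t"
      "2 * \<rho> \<le> t - h - tk j" "2 * \<rho> \<le> tk (j + 1) - (t - h)" "2 * \<rho> \<le> \<eta> / (3 * A)"
      using d(1) k j A \<open>\<eta> > 0\<close> by (auto simp: \<rho>_def)
    note \<rho> = this
    have "A * (2 * \<rho>) \<le> \<eta> / 3"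
      using \<rho>(7) A by (simp add: field_simps)
    then have A\<rho>: "A * \<rho> \<le> \<eta> / 3"
      using \<rho>(1) A mult_left_mono[of \<rho> "2 * \<rho>" A] by linarith
    have L\<rho>: "\<bar>L\<bar> * ((M * \<rho> + \<rho>) + (M' * \<rho> + \<rho>)) \<le> \<eta> / 3"
      using A\<rho> \<rho>(1) by (simp add: A_def algebra_simps)
    have "\<forall>\<^sub>F n in sequentially. norm (\<xi> (t + \<sigma> n) - p t) < \<rho>"
      using tendstoD[OF \<xi>_tendsto_translate[OF k] \<rho>(1)] by (simp add: dist_norm)
    moreover have "\<forall>\<^sub>F n in sequentially. norm (\<xi> (t - h + \<sigma> n) - p (t - h)) < \<rho>"
      using tendstoD[OF \<xi>_tendsto_translate[OF j] \<rho>(1)] by (simp add: dist_norm)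
    moreover have "\<forall>\<^sub>F n in sequentially. \<forall>x\<in>cball 0 B. \<forall>y\<in>cball 0 B. norm (f (t + \<sigma> n) x y - f t x y) < \<eta> / 3"
      using \<open>\<eta> > 0\<close> by (intro f_tendsto[OF k]) simp
    moreover have "\<forall>\<^sub>F n in sequentially. tk (k + m n) < (t - \<rho>) + \<sigma> n"
      using \<rho> by (intro eventually_shift_gt) auto
    moreover have "\<forall>\<^sub>F n in sequentially. (t + \<rho>) + \<sigma> n < tk (k + 1 + m n)"
      using \<rho> by (intro eventually_shift_lt) auto
    moreover have "\<forall>\<^sub>F n in sequentially. tk (j + m n) < (t - h - \<rho>) + \<sigma> n"
      using \<rho> by (intro eventually_shift_gt) auto
    moreover have "\<forall>\<^sub>F n in sequentially. (t - h + \<rho>) + \<sigma> n < tk (j + 1 + m n)"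
      using \<rho> by (intro eventually_shift_lt) auto
    moreover have "\<forall>\<^sub>F n in sequentially. \<bar>t\<bar> + \<bar>h\<bar> + \<rho> \<le> \<sigma> n"
      by (rule eventually_\<sigma>_ge)
    ultimately have ev: "\<forall>\<^sub>F n in sequentially. \<forall>a b. t - \<rho> < a \<and> a \<le> b \<and> b < t + \<rho> \<longrightarrow>
        norm (\<xi> (b + \<sigma> n) - \<xi> (a + \<sigma> n) - (b - a) *\<^sub>R c) \<le> \<eta> * (b - a)"
      using M(2) M'(2)
    proof eventually_elim
      case (elim n)
      have near: "norm (\<xi> v - \<xi> (t + \<sigma> n)) \<le> M * \<rho>" if "\<bar>v - \<sigma> n - t\<bar> < \<rho>" for v
      proof -
        have "norm (\<xi> v - \<xi> (t + \<sigma> n)) \<le> M * \<bar>v - (t + \<sigma> n)\<bar>"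
          using elim(9)[rule_format, of v "t + \<sigma> n"] elim(9)[rule_format, of "t + \<sigma> n" v] elim(4,5) that
          by (cases "v \<le> t + \<sigma> n") (auto simp: norm_minus_commute)
        also have "\<dots> \<le> M * \<rho>" using that M(1) by (intro mult_left_mono) auto
        finally show ?thesis .
      qed
      have near': "norm (\<xi> v - \<xi> (t - h + \<sigma> n)) \<le> M' * \<rho>" if "\<bar>v - \<sigma> n - (t - h)\<bar> < \<rho>" for v
      proof -
        have "norm (\<xi> v - \<xi> (t - h + \<sigma> n)) \<le> M' * \<bar>v - (t - h + \<sigma> n)\<bar>"
          using elim(10)[rule_format, of v "t - h + \<sigma> n"] elim(10)[rule_format, of "t - h + \<sigma> n" v] elim(6,7) that
          by (cases "v \<le> t - h + \<sigma> n") (auto simp: norm_minus_commute)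
        also have "\<dots> \<le> M' * \<rho>" using that M'(1) by (intro mult_left_mono) auto
        finally show ?thesis .
      qed
      \<comment> \<open>Three thirds of \<eta>: moving the time to \<open>t + \<sigma> n\<close>
        inside a shifted interval, removing the shift, and replacing the arguments by
        \<open>p t\<close> and \<open>p (t - h)\<close>.\<close>
      have rhs: "norm (f v (\<xi> v) (\<xi> (v - h)) - c) \<le> \<eta>" if v: "\<bar>v - \<sigma> n - t\<bar> < \<rho>" for v
      proof -
        have "0 \<le> v" "0 \<le> v - h" using v elim(8) by auto
        then have X: "\<xi> v \<in> cball 0 B" and Y: "\<xi> (v - h) \<in> cball 0 B" by (simp_all only: bounded)
        have "same_interval tk v (t + \<sigma> n)"
          using v elim(4,5) by (intro same_interval_shift[of k n]) auto
        then have 1: "norm (f v (\<xi> v) (\<xi> (v - h)) - f (t + \<sigma> n) (\<xi> v) (\<xi> (v - h))) < \<eta> / 3"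
          using v \<rho> by (intro d(2)[OF X Y]) auto
        have 2: "norm (f (t + \<sigma> n) (\<xi> v) (\<xi> (v - h)) - f t (\<xi> v) (\<xi> (v - h))) < \<eta> / 3"
          using elim(3) X Y by blast
        have "norm (\<xi> v - p t) \<le> M * \<rho> + \<rho>"
          using near[OF v] elim(1) norm_triangle_ineq[of "\<xi> v - \<xi> (t + \<sigma> n)" "\<xi> (t + \<sigma> n) - p t"]
          by simp
        moreover have "norm (\<xi> (v - h) - p (t - h)) \<le> M' * \<rho> + \<rho>"
          using near'[of "v - h"] v elim(2)
            norm_triangle_ineq[of "\<xi> (v - h) - \<xi> (t - h + \<sigma> n)" "\<xi> (t - h + \<sigma> n) - p (t - h)"]
          by (simp add: algebra_simps)
        ultimately have "\<bar>L\<bar> * (norm (\<xi> v - p t) + norm (\<xi> (v - h) - p (t - h)))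
            \<le> \<bar>L\<bar> * ((M * \<rho> + \<rho>) + (M' * \<rho> + \<rho>))"
          by (intro mult_left_mono add_mono) auto
        moreover have "L * (norm (\<xi> v - p t) + norm (\<xi> (v - h) - p (t - h)))
            \<le> \<bar>L\<bar> * (norm (\<xi> v - p t) + norm (\<xi> (v - h) - p (t - h)))"
          by (intro mult_right_mono) auto
        ultimately have 3: "norm (f t (\<xi> v) (\<xi> (v - h)) - c) \<le> \<eta> / 3"
          using f_lip[OF X in_ball[OF k] Y in_ball[OF j], of t] L\<rho> unfolding c_def by linarith
        show ?thesis using 1 2 3 by norm
      qed
      show ?case
      proof (intro allI impI)
        fix a b assume ab: "t - \<rho> < a \<and> a \<le> b \<and> b < t + \<rho>"
        have "norm (\<xi> (b + \<sigma> n) - \<xi> (a + \<sigma> n) - ((b + \<sigma> n) - (a + \<sigma> n)) *\<^sub>R c) \<le> \<eta> * ((b + \<sigma> n) - (a + \<sigma> n))"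
        proof (rule \<xi>_increment_le[where k = "k + m n"])
          show "b + \<sigma> n \<le> tk (k + m n + 1)" using elim(5) ab by (simp add: algebra_simps)
          show "norm (f v (\<xi> v) (\<xi> (v - h)) - c) \<le> \<eta>" if "a + \<sigma> n < v" "v < b + \<sigma> n" for v
            using that ab by (intro rhs) auto
        qed (use ab elim(4,8) \<open>\<eta> > 0\<close> in auto)
        then show "norm (\<xi> (b + \<sigma> n) - \<xi> (a + \<sigma> n) - (b - a) *\<^sub>R c) \<le> \<eta> * (b - a)" by simp
      qed
    qed
    have "norm (p b - p a - (b - a) *\<^sub>R c) \<le> \<eta> * (b - a)" if ab: "t - \<rho> < a" "a \<le> b" "b < t + \<rho>" for a b
    proof (rule tendsto_upperbound)
      show "(\<lambda>n. norm (\<xi> (b + \<sigma> n) - \<xi> (a + \<sigma> n) - (b - a) *\<^sub>R c)) \<longlonglongrightarrow> norm (p b - p a - (b - a) *\<^sub>R c)"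
        using ab \<rho> by (intro tendsto_intros \<xi>_tendsto_translate[of k]) auto
      show "\<forall>\<^sub>F n in sequentially. norm (\<xi> (b + \<sigma> n) - \<xi> (a + \<sigma> n) - (b - a) *\<^sub>R c) \<le> \<eta> * (b - a)"
        using ev by eventually_elim (use ab in auto)
    qed simp
    with \<rho>(1) show ?thesis by blast
  qed
  show ?thesis
    unfolding has_vector_derivative_def has_derivative_within_alt
  proof (intro conjI allI impI)
    fix \<eta> :: real assume "\<eta> > 0"
    from main[OF this] obtain \<rho> where \<rho>: "\<rho> > 0"
      "\<And>a b. t - \<rho> < a \<Longrightarrow> a \<le> b \<Longrightarrow> b < t + \<rho> \<Longrightarrow> norm (p b - p a - (b - a) *\<^sub>R c) \<le> \<eta> * (b - a)"
      by blast
    have "norm (p y - p t - (y - t) *\<^sub>R c) \<le> \<eta> * norm (y - t)" if "norm (y - t) < \<rho>" for y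
    proof (cases "t \<le> y")
      case True
      then show ?thesis using \<rho>(2)[of t y] \<rho>(1) that by auto
    next
      case False
      have "p y - p t - (y - t) *\<^sub>R c = - (p t - p y - (t - y) *\<^sub>R c)" by (simp add: algebra_simps)
      then show ?thesis using \<rho>(2)[of y t] \<rho>(1) that False by (simp only: norm_minus_cancel) auto
    qed
    with \<rho>(1) show "\<exists>d>0. \<forall>y\<in>UNIV. norm (y - t) < d \<longrightarrow>
        norm (p y - p t - (y - t) *\<^sub>R f t (p t) (p (t - h))) \<le> \<eta> * norm (y - t)"
      unfolding c_def by blast
  qed (rule bounded_linear_scaleR_left)
qed

lemma impulsive_solution_limit: "impulsive_solution tk h f I UNIV p"
  unfolding impulsive_solution_def
  using p_continuous p_derivative p_left p_jump by simp

end

section \<open>Choice of the shifts and verification of the setting\<close>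

theorem theorem1:
  fixes tk :: "int \<Rightarrow> real" and h :: real
    and f :: "real \<Rightarrow> real ^ 'n \<Rightarrow> real ^ 'n \<Rightarrow> real ^ 'n"
    and I :: "int \<Rightarrow> real ^ 'n \<Rightarrow> real ^ 'n"
    and \<xi> :: "real \<Rightarrow> real ^ 'n" and B :: real
  assumes h_pos: "h > 0"
    and tk_seq: "disc_seq tk"
    and tk_uap: "uap_differences tk"
    and f_Wap: "W_ap_uniform tk f"
    and f_lip: "lipschitz_xy_compact f"
    and I_ap: "ap_seq_uniform I"
    and I_lip: "\<forall>k. \<exists>L. \<forall>x y. norm (I k x - I k y) \<le> L * norm (x - y)"
    and xi_sol: "impulsive_solution tk h f I {0..} \<xi>"
    and xi_bdd: "\<forall>t\<ge>0. norm (\<xi> t) \<le> B"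
    and xi_aap: "W_asymp_almost_periodic \<xi>"
  shows "\<exists>p. impulsive_solution tk h f I UNIV p \<and> W_almost_periodic p"
proof -
  obtain p q where p: "W_almost_periodic p" and q: "(q \<longlongrightarrow> 0) at_top"
    and \<xi>: "\<And>t. t \<ge> 0 \<Longrightarrow> \<xi> t = p t + q t"
    using xi_aap unfolding W_asymp_almost_periodic_def by blast
  obtain \<tau> where \<tau>: "W_ap_wrt \<tau> p" using p unfolding W_almost_periodic_def by blast
  then have \<tau>_seq: "disc_seq \<tau>" and \<tau>_uap: "uap_differences \<tau>" and p_PC: "PC_wrt \<tau> UNIV p"
    by (auto simp: W_ap_wrt_def)
  define K where "K = cball (0 :: real ^ 'n) B"
  have K: "compact K" by (simp add: K_def)
  define \<epsilon> where "\<epsilon> n = inverse (real (Suc n))" for n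
  have \<epsilon>: "\<epsilon> n > 0" for n by (simp add: \<epsilon>_def)
  have \<epsilon>_lim: "\<epsilon> \<longlonglongrightarrow> 0" unfolding \<epsilon>_def by (rule LIMSEQ_inverse_real_of_nat)
  have "\<forall>\<epsilon>>0. \<exists>\<Gamma>. rel_dense_real \<Gamma> \<and>
      (\<forall>s\<in>\<Gamma>. \<forall>t. (\<forall>k. \<epsilon> \<le> \<bar>t - \<tau> k\<bar>) \<longrightarrow> norm (p (t + s) - p t) < \<epsilon>)"
    using \<tau> unfolding W_ap_wrt_def by (elim conjE)
  then have "\<forall>n. \<exists>\<Gamma>. rel_dense_real \<Gamma> \<and>
      (\<forall>s\<in>\<Gamma>. \<forall>t. (\<forall>k. \<epsilon> n \<le> \<bar>t - \<tau> k\<bar>) \<longrightarrow> norm (p (t + s) - p t) < \<epsilon> n)"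
    using \<epsilon> by simp
  then obtain \<Gamma>\<^sub>p where \<Gamma>\<^sub>p: "\<And>n. rel_dense_real (\<Gamma>\<^sub>p n)"
    "\<And>n s t. s \<in> \<Gamma>\<^sub>p n \<Longrightarrow> (\<And>k. \<epsilon> n \<le> \<bar>t - \<tau> k\<bar>) \<Longrightarrow> norm (p (t + s) - p t) < \<epsilon> n"
    by metis
  have f_ucont: "\<forall>\<epsilon>>0. \<exists>\<delta>>0. \<forall>x\<in>K. \<forall>y\<in>K. \<forall>t' t''. same_interval tk t' t'' \<and> \<bar>t' - t''\<bar> < \<delta> \<longrightarrow>
        norm (f t' x y - f t'' x y) < \<epsilon>"
    and "\<forall>\<epsilon>>0. \<exists>\<Gamma>. rel_dense_real \<Gamma> \<and>
      (\<forall>s\<in>\<Gamma>. \<forall>t. (\<forall>k. \<epsilon> \<le> \<bar>t - tk k\<bar>) \<longrightarrow>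
        (\<forall>x\<in>K. \<forall>y\<in>K. norm (f (t + s) x y - f t x y) < \<epsilon>))"
    using f_Wap K unfolding W_ap_uniform_def by simp_all
  then have "\<forall>n. \<exists>\<Gamma>. rel_dense_real \<Gamma> \<and>
      (\<forall>s\<in>\<Gamma>. \<forall>t. (\<forall>k. \<epsilon> n \<le> \<bar>t - tk k\<bar>) \<longrightarrow>
        (\<forall>x\<in>K. \<forall>y\<in>K. norm (f (t + s) x y - f t x y) < \<epsilon> n))"
    using \<epsilon> by simp
  then obtain \<Gamma>\<^sub>f where \<Gamma>\<^sub>f: "\<And>n. rel_dense_real (\<Gamma>\<^sub>f n)"
    "\<And>n s t x y. s \<in> \<Gamma>\<^sub>f n \<Longrightarrow> (\<And>k. \<epsilon> n \<le> \<bar>t - tk k\<bar>) \<Longrightarrow> x \<in> K \<Longrightarrow> y \<in> K \<Longrightarrow>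
      norm (f (t + s) x y - f t x y) < \<epsilon> n"
    by metis
  \<comment> \<open>One shift for each tolerance \<open>\<epsilon> n\<close>; the lower bound
    \<open>real n\<close> drives the shifts to infinity.\<close>
  have "\<forall>n. \<exists>\<sigma> m. real n \<le> \<sigma> \<and> (\<forall>k. \<bar>tk (k + m) - tk k - \<sigma>\<bar> < \<epsilon> n) \<and>
      (\<forall>k. \<forall>x\<in>K. norm (I (k + m) x - I k x) < \<epsilon> n) \<and>
      (\<exists>s\<in>\<Gamma>\<^sub>p n. \<exists>s'\<in>\<Gamma>\<^sub>p n. \<bar>\<sigma> - (s - s')\<bar> < \<epsilon> n) \<and>
      (\<exists>s\<in>\<Gamma>\<^sub>f n. \<exists>s'\<in>\<Gamma>\<^sub>f n. \<bar>\<sigma> - (s - s')\<bar> < \<epsilon> n)"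
  proof
    fix n
    obtain \<sigma> m where "real n \<le> \<sigma>" "\<And>k. \<bar>tk (k + m) - tk k - \<sigma>\<bar> < \<epsilon> n"
      "\<And>k x. x \<in> K \<Longrightarrow> norm (I (k + m) x - I k x) < \<epsilon> n"
      "\<exists>s\<in>\<Gamma>\<^sub>p n. \<exists>s'\<in>\<Gamma>\<^sub>p n. \<bar>\<sigma> - (s - s')\<bar> < \<epsilon> n"
      "\<exists>s\<in>\<Gamma>\<^sub>f n. \<exists>s'\<in>\<Gamma>\<^sub>f n. \<bar>\<sigma> - (s - s')\<bar> < \<epsilon> n"
      using common_translations[OF tk_seq tk_uap I_ap K \<Gamma>\<^sub>p(1) \<Gamma>\<^sub>f(1) \<epsilon>, of "real n" n n n] by blast
    then show "\<exists>\<sigma> m. real n \<le> \<sigma> \<and> (\<forall>k. \<bar>tk (k + m) - tk k - \<sigma>\<bar> < \<epsilon> n) \<and>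
      (\<forall>k. \<forall>x\<in>K. norm (I (k + m) x - I k x) < \<epsilon> n) \<and>
      (\<exists>s\<in>\<Gamma>\<^sub>p n. \<exists>s'\<in>\<Gamma>\<^sub>p n. \<bar>\<sigma> - (s - s')\<bar> < \<epsilon> n) \<and>
      (\<exists>s\<in>\<Gamma>\<^sub>f n. \<exists>s'\<in>\<Gamma>\<^sub>f n. \<bar>\<sigma> - (s - s')\<bar> < \<epsilon> n)"
      by blast
  qed
  then obtain \<sigma> m where \<sigma>: "\<And>n. real n \<le> \<sigma> n"
    and tk_close: "\<And>n k. \<bar>tk (k + m n) - tk k - \<sigma> n\<bar> < \<epsilon> n"
    and I_close: "\<And>n k x. x \<in> K \<Longrightarrow> norm (I (k + m n) x - I k x) < \<epsilon> n"
    and \<sigma>_p: "\<And>n. \<exists>s\<in>\<Gamma>\<^sub>p n. \<exists>s'\<in>\<Gamma>\<^sub>p n. \<bar>\<sigma> n - (s - s')\<bar> < \<epsilon> n"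
    and \<sigma>_f: "\<And>n. \<exists>s\<in>\<Gamma>\<^sub>f n. \<exists>s'\<in>\<Gamma>\<^sub>f n. \<bar>\<sigma> n - (s - s')\<bar> < \<epsilon> n"
    unfolding choice_iff by blast
  have \<sigma>_top: "filterlim \<sigma> at_top sequentially"
    by (rule filterlim_at_top_mono[OF filterlim_real_sequentially]) (simp add: \<sigma>)
  obtain L where L: "\<And>t x x' y y'. x \<in> K \<Longrightarrow> x' \<in> K \<Longrightarrow> y \<in> K \<Longrightarrow> y' \<in> K \<Longrightarrow>
      norm (f t x y - f t x' y') \<le> L * (norm (x - x') + norm (y - y'))"
    using f_lip K unfolding lipschitz_xy_compact_def by metis
  interpret translated_bounded_solution tk h f I \<xi> p B L \<sigma> m
    unfolding translated_bounded_solution_def K_def[symmetric]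
  proof (intro conjI allI impI)
    show "\<exists>\<delta>>0. \<forall>x\<in>K. \<forall>y\<in>K. \<forall>t' t''. same_interval tk t' t'' \<and> \<bar>t' - t''\<bar> < \<delta> \<longrightarrow>
        norm (f t' x y - f t'' x y) < \<epsilon>" if "\<epsilon> > 0" for \<epsilon>
      using f_ucont that by simp
    show "isCont (I k) x" for k x
    proof -
      obtain l where l: "\<And>x y. norm (I k x - I k y) \<le> l * norm (x - y)" using I_lip by blast
      have "((\<lambda>y. I k y - I k x) \<longlongrightarrow> 0) (at x)"
      proof (rule Lim_null_comparison)
        show "\<forall>\<^sub>F y in at x. norm (I k y - I k x) \<le> l * norm (y - x)" using l by simp
        have "((\<lambda>y. l * norm (y - x)) \<longlongrightarrow> l * norm (x - x)) (at x)" by (intro tendsto_intros)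
        then show "((\<lambda>y. l * norm (y - x)) \<longlongrightarrow> 0) (at x)" by simp
      qed
      then show ?thesis unfolding isCont_def by (rule LIM_zero_cancel)
    qed
    show "continuous (at u within {..u}) p" for u
      using p_PC unfolding PC_wrt_def
      by (cases "u \<in> range \<tau>") (auto intro: continuous_within_subset)
    show "(\<lambda>n. tk (k + m n) - \<sigma> n) \<longlonglongrightarrow> tk k" for k
    proof (rule LIM_zero_cancel, rule Lim_null_comparison[OF _ \<epsilon>_lim])
      show "\<forall>\<^sub>F n in sequentially. norm (tk (k + m n) - \<sigma> n - tk k) \<le> \<epsilon> n"
        using tk_close[of k] by (intro always_eventually) (simp add: algebra_simps less_imp_le)
    qed
    show "\<forall>\<^sub>F n in sequentially. \<forall>x\<in>K. norm (I (k + m n) x - I k x) < \<eta>" if "\<eta> > 0" for k \<eta>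
      using order_tendstoD(2)[OF \<epsilon>_lim that]
      by eventually_elim (use I_close in \<open>blast intro: less_trans\<close>)
    show "\<forall>\<^sub>F n in sequentially. \<exists>u'\<in>{u..u+\<delta>}. \<exists>e. \<bar>e\<bar> < \<eta> \<and>
        (\<forall>x\<in>K. \<forall>y\<in>K. norm (f (u' + \<sigma> n) x y - f (u' + e) x y) < \<eta>)"
      if "\<delta> > 0" "\<eta> > 0" for u \<delta> \<eta>
      \<comment> \<open>Both state arguments are packed into the parameter, so the same
        \<open>u'\<close> and \<open>e\<close> work for all of them.\<close>
      using almost_period_difference[OF tk_seq tk_uap \<epsilon>_lim _ \<sigma>_f that,
          of "K \<times> K" "\<lambda>t z. f t (fst z) (snd z)" u] \<Gamma>\<^sub>f(2)
      by (simp add: mem_Times_iff)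
    show "\<forall>\<^sub>F n in sequentially. \<exists>u'\<in>{u..u+\<delta>}. \<exists>e. \<bar>e\<bar> < \<eta> \<and>
        norm (\<xi> (u' + \<sigma> n) - p (u' + e)) < \<eta>"
      if "\<delta> > 0" "\<eta> > 0" for u \<delta> \<eta>
    proof -
      have \<eta>2: "\<eta> / 2 > 0" using that by simp
      have p_shift: "\<forall>\<^sub>F n in sequentially. \<exists>u'\<in>{u..u+\<delta>}. \<exists>e. \<bar>e\<bar> < \<eta> / 2 \<and>
          norm (p (u' + \<sigma> n) - p (u' + e)) < \<eta> / 2"
        \<comment> \<open>Here the discontinuities are those of \<open>p\<close>, and a one-point
          parameter set suffices.\<close>
        using almost_period_difference[OF \<tau>_seq \<tau>_uap \<epsilon>_lim _ \<sigma>_p \<open>\<delta> > 0\<close> \<eta>2,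
            of UNIV "\<lambda>t (_::unit). p t" u] \<Gamma>\<^sub>p(2)
        by simp
      \<comment> \<open>At late times \<xi> differs from \<open>p\<close> by the vanishing part
        \<open>q\<close>, so half of \<eta> pays for replacing \<open>p\<close> by \<xi>.\<close>
      have "\<forall>\<^sub>F t in at_top. norm (q t) < \<eta> / 2"
        using tendstoD[OF q \<eta>2] by (simp add: dist_norm)
      then obtain T where T: "\<And>t. t \<ge> T \<Longrightarrow> norm (q t) < \<eta> / 2"
        by (auto simp: eventually_at_top_linorder)
      have "\<forall>\<^sub>F n in sequentially. max 0 T - u \<le> \<sigma> n"
        using \<sigma>_top by (simp add: filterlim_at_top)
      with p_shift show ?thesis
      proof eventually_elim
        case (elim n)
        then obtain u' e where u': "u' \<in> {u..u+\<delta>}" "\<bar>e\<bar> < \<eta> / 2"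
          "norm (p (u' + \<sigma> n) - p (u' + e)) < \<eta> / 2" by blast
        have "0 \<le> u' + \<sigma> n" "T \<le> u' + \<sigma> n" using u'(1) elim(2) by auto
        then have "norm (\<xi> (u' + \<sigma> n) - p (u' + \<sigma> n)) < \<eta> / 2"
          using \<xi> T by simp
        then have "norm (\<xi> (u' + \<sigma> n) - p (u' + e)) < \<eta>" using u'(3) by norm
        with u'(1,2) \<eta>2 show ?case by (intro bexI[of _ u'] exI[of _ e]) auto
      qed
    qed
  qed (use tk_seq L xi_sol xi_bdd \<sigma>_top in \<open>auto simp: K_def\<close>)
  show ?thesis using impulsive_solution_limit p by blast
qed

end
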